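(* Let $\omega$ be a non-constant real-valued function in $L^\infty(\mathbb T)$ satisfying: there is a finite set $\mathsf S=\{\eta_k\}\subset\mathbb T$ such that $\omega\in C^1(\mathbb T\setminus\mathsf S)$; the one-sided limits $\omega(\eta_k\pm0)$ exist for all $\eta_k\in\mathsf S$; and for every $\eta_k\in\mathsf S$ either $\omega(\eta_k+0)\neq\omega(\eta_k-0)$, or $\omega(\eta_k+0)=\omega(\eta_k-0)$ but the derivative $\omega'$ is not continuous at $\eta_k$. Let $\gamma_1=\operatorname{ess\,inf}\omega$, $\gamma_2=\operatorname{ess\,sup}\omega$, and let the open interval $\Lambda=(\lambda_1,\lambda_2)$ satisfy $\Lambda\subset(\gamma_1,\gamma_2)\setminus\Lambda_{\mathrm{exc}}$. Then for each $\lambda\in\Lambda$ the set $\Gamma(\lambda)=\{\zeta\in\mathbb T:\omega(\zeta)<\lambda\}$ is (up to a set of measure zero) a union $\bigcup_{j=1}^m(\alpha_j(\lambda),\beta_j(\lambda))$ of finitely many open arcs $(\alpha_j(\lambda),\beta_j(\lambda))\subset\mathbb T\setminus\mathsf S(\Lambda)$ such that their closures are disjoint. The number $m=m(\Lambda)$ of these arcs does not depend on $\lambda\in\Lambda$ and, for both signs "$\pm$", $$m(\Lambda)=n^{(\pm)}(\Lambda)+s^{(\pm)}(\Lambda).$$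
   Context: $\mathbb T$ is the unit circle; $(\zeta_1,\zeta_2)\subset\mathbb T$ denotes the open arc joining $\zeta_1$ to $\zeta_2$ counterclockwise. $\omega'(\zeta)=d\omega(e^{i\theta})/d\theta$ for $\zeta=e^{i\theta}$, and $\omega(\eta\pm0)=\lim_{\varepsilon\to\pm0}\omega(\eta e^{i\varepsilon})$. $\mathsf S^{(\pm)}=\{\eta_k\in\mathsf S:\pm(\omega(\eta_k-0)-\omega(\eta_k+0))>0\}$. To each $\eta_k\in\mathsf S^{(\pm)}$ is associated the interval (jump) $\Lambda_k=[\omega(\eta_k\pm0),\omega(\eta_k\mp0)]$. Exceptional set: $\mathsf S_{\mathrm{cr}}=\{\zeta\in\mathbb T\setminus\mathsf S:\omega'(\zeta)=0\}$, $\Lambda_{\mathrm{cr}}=\omega(\mathsf S_{\mathrm{cr}})$, $\Lambda_{\mathrm{thr}}$ is the set of all values $\omega(\eta_k\pm0)$, $\eta_k\in\mathsf S$, and $\Lambda_{\mathrm{exc}}=\Lambda_{\mathrm{cr}}\cup\Lambda_{\mathrm{thr}}$. Counting functions: the open set $\omega^{-1}(\Lambda)=\{\zeta\in\mathbb T\setminus\mathsf S:\omega(\zeta)\in\Lambda\}$ is a disjoint union of open arcs on each of which $\omega'\neq0$; $n^{(\pm)}(\Lambda)$ is the number of those arcs on which $\mp\omega'>0$. $\mathsf S(\Lambda)$ is the set of those $\eta_k\in\mathsf S^{(+)}\cup\mathsf S^{(-)}$ for which $\Lambda\subset\Lambda_k$, $\mathsf S^{(\pm)}(\Lambda)=\mathsf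 S(\Lambda)\cap\mathsf S^{(\pm)}$, and $s^{(\pm)}(\Lambda)=\#\mathsf S^{(\pm)}(\Lambda)$. *)

theory Defs
  imports "HOL-Analysis.Analysis" "HOL-Probability.Essential_Supremum"
begin

abbreviation unit_circle :: "complex set" where
  "unit_circle \<equiv> sphere 0 1"

(* Arc length. Functions on the circle are total functions on the complex plane; their values
   off the circle are never used. *)
definition circle_measure :: "complex measure" where
  "circle_measure =
     distr (restrict_space lborel {0..<2*pi}) (restrict_space borel unit_circle) cis"

(* The open arc from a to b, counterclockwise. It is empty for a = b. *)
definition circle_arc :: "complex \<Rightarrow> complex \<Rightarrow> complex set" where
  "circle_arc a b = {a * cis t | t. 0 < t \<and> t < Arg2pi (b / a)}"

definition circle_Linf :: "(complex \<Rightarrow> real) \<Rightarrow> bool" where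
  "circle_Linf \<omega> \<longleftrightarrow> \<omega> \<in> borel_measurable circle_measure \<and>
     (\<exists>C. AE \<zeta> in circle_measure. \<bar>\<omega> \<zeta>\<bar> \<le> C)"

definition circle_esssup :: "(complex \<Rightarrow> real) \<Rightarrow> ereal" where
  "circle_esssup \<omega> = esssup circle_measure (\<lambda>\<zeta>. ereal (\<omega> \<zeta>))"

definition circle_essinf :: "(complex \<Rightarrow> real) \<Rightarrow> ereal" where
  "circle_essinf \<omega> = - esssup circle_measure (\<lambda>\<zeta>. - ereal (\<omega> \<zeta>))"

definition circle_diff :: "(complex \<Rightarrow> real) \<Rightarrow> complex \<Rightarrow> bool" where
  "circle_diff \<omega> \<zeta> \<longleftrightarrow> (\<lambda>\<theta>. \<omega> (cis \<theta>)) differentiable at (Arg \<zeta>)"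

definition circle_deriv :: "(complex \<Rightarrow> real) \<Rightarrow> complex \<Rightarrow> real" where
  "circle_deriv \<omega> \<zeta> = deriv (\<lambda>\<theta>. \<omega> (cis \<theta>)) (Arg \<zeta>)"

definition circle_C1_on :: "complex set \<Rightarrow> (complex \<Rightarrow> real) \<Rightarrow> bool" where
  "circle_C1_on U \<omega> \<longleftrightarrow> (\<forall>\<zeta>\<in>U. circle_diff \<omega> \<zeta>) \<and> continuous_on U (circle_deriv \<omega>)"

definition deriv_continuous_at :: "(complex \<Rightarrow> real) \<Rightarrow> complex \<Rightarrow> bool" where
  "deriv_continuous_at \<omega> \<eta> \<longleftrightarrow>
     circle_diff \<omega> \<eta> \<and> continuous (at \<eta> within unit_circle) (circle_deriv \<omega>)"

(* The one-sided limits \<omega>(\<eta> + 0) and \<omega>(\<eta> - 0); they are meaningful only where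
   has_one_sided_limits holds. *)
definition lim_plus :: "(complex \<Rightarrow> real) \<Rightarrow> complex \<Rightarrow> real" where
  "lim_plus \<omega> \<eta> = Lim (at_right 0) (\<lambda>\<epsilon>. \<omega> (\<eta> * cis \<epsilon>))"

definition lim_minus :: "(complex \<Rightarrow> real) \<Rightarrow> complex \<Rightarrow> real" where
  "lim_minus \<omega> \<eta> = Lim (at_left 0) (\<lambda>\<epsilon>. \<omega> (\<eta> * cis \<epsilon>))"

definition has_one_sided_limits :: "(complex \<Rightarrow> real) \<Rightarrow> complex \<Rightarrow> bool" where
  "has_one_sided_limits \<omega> \<eta> \<longleftrightarrow>
     (\<exists>l. ((\<lambda>\<epsilon>. \<omega> (\<eta> * cis \<epsilon>)) \<longlongrightarrow> l) (at_right 0)) \<and>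
     (\<exists>l. ((\<lambda>\<epsilon>. \<omega> (\<eta> * cis \<epsilon>)) \<longlongrightarrow> l) (at_left 0))"

(* \<omega> is an element of an L-infinity space, so its values at the finitely many points of S are
   irrelevant: continuity of the derivative at a point \<eta> of S where the two one-sided limits
   agree refers to \<omega> with their common value assigned at \<eta>. *)
definition genuine_singularity :: "(complex \<Rightarrow> real) \<Rightarrow> complex \<Rightarrow> bool" where
  "genuine_singularity \<omega> \<eta> \<longleftrightarrow>
     lim_plus \<omega> \<eta> \<noteq> lim_minus \<omega> \<eta> \<or>
     (lim_plus \<omega> \<eta> = lim_minus \<omega> \<eta> \<and> \<not> deriv_continuous_at (fun_upd \<omega> \<eta> (lim_plus \<omega> \<eta>)) \<eta>)"

(* In the following, the sign of a superscript (+) or (-) is a real number \<sigma> = 1 or \<sigma> = -1. *)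

definition jump_points :: "real \<Rightarrow> (complex \<Rightarrow> real) \<Rightarrow> complex set \<Rightarrow> complex set" where
  "jump_points \<sigma> \<omega> S = {\<eta>\<in>S. \<sigma> * (lim_minus \<omega> \<eta> - lim_plus \<omega> \<eta>) > 0}"

definition jump_interval :: "(complex \<Rightarrow> real) \<Rightarrow> complex \<Rightarrow> real set" where
  "jump_interval \<omega> \<eta> =
     (if lim_minus \<omega> \<eta> > lim_plus \<omega> \<eta>
      then {lim_plus \<omega> \<eta>..lim_minus \<omega> \<eta>} else {lim_minus \<omega> \<eta>..lim_plus \<omega> \<eta>})"

definition Lambda_cr :: "(complex \<Rightarrow> real) \<Rightarrow> complex set \<Rightarrow> real set" where
  "Lambda_cr \<omega> S = \<omega> ` {\<zeta> \<in> unit_circle - S. circle_deriv \<omega> \<zeta> = 0}"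

definition Lambda_thr :: "(complex \<Rightarrow> real) \<Rightarrow> complex set \<Rightarrow> real set" where
  "Lambda_thr \<omega> S = lim_plus \<omega> ` S \<union> lim_minus \<omega> ` S"

definition Lambda_exc :: "(complex \<Rightarrow> real) \<Rightarrow> complex set \<Rightarrow> real set" where
  "Lambda_exc \<omega> S = Lambda_cr \<omega> S \<union> Lambda_thr \<omega> S"

(* The arcs that constitute the open set \<omega>^{-1}(\<Lambda>) are its connected components. *)
definition preimage_arcs :: "(complex \<Rightarrow> real) \<Rightarrow> complex set \<Rightarrow> real set \<Rightarrow> complex set set" where
  "preimage_arcs \<omega> S \<Lambda> = components {\<zeta> \<in> unit_circle - S. \<omega> \<zeta> \<in> \<Lambda>}"

(* card is 0 on infinite sets, so this is the number of arcs only if preimage_arcs is finite. *)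
definition n_count :: "real \<Rightarrow> (complex \<Rightarrow> real) \<Rightarrow> complex set \<Rightarrow> real set \<Rightarrow> nat" where
  "n_count \<sigma> \<omega> S \<Lambda> = card {C \<in> preimage_arcs \<omega> S \<Lambda>. \<forall>\<zeta>\<in>C. - \<sigma> * circle_deriv \<omega> \<zeta> > 0}"

definition S_of :: "(complex \<Rightarrow> real) \<Rightarrow> complex set \<Rightarrow> real set \<Rightarrow> complex set" where
  "S_of \<omega> S \<Lambda> =
     {\<eta> \<in> jump_points 1 \<omega> S \<union> jump_points (-1) \<omega> S. \<Lambda> \<subseteq> jump_interval \<omega> \<eta>}"

definition s_count :: "real \<Rightarrow> (complex \<Rightarrow> real) \<Rightarrow> complex set \<Rightarrow> real set \<Rightarrow> nat" where
  "s_count \<sigma> \<omega> S \<Lambda> = card (S_of \<omega> S \<Lambda> \<inter> jump_points \<sigma> \<omega> S)"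

definition sublevel :: "(complex \<Rightarrow> real) \<Rightarrow> real \<Rightarrow> complex set" where
  "sublevel \<omega> l = {\<zeta> \<in> unit_circle. \<omega> \<zeta> < l}"

end

theory Submission
  imports Defs
begin

text \<open>
  Put f t = \<omega> (cis t). For l in \<Lambda>, the condition f < l has a constant truth value on a small
  one-sided neighbourhood of every point: one-sided limits at S differ from l, and off S either
  f \<noteq> l or f = l with nonzero derivative. Hence the points near which f < l on both sides
  form an open set that differs from the sublevel set by finitely many points. The gaps between
  consecutive points of its complement are arcs that start where f passes from above to below l and
  end where it passes from below to above l, so m counts either kind of crossing. A crossing is a
  jump whose interval contains \<Lambda>, or a point with f = l. Each component of the preimage of
  \<Lambda> contains exactly one of the latter: at both ends of the component the limits of f lie in
  {l1, l2}, and Rolle's theorem makes them distinct and f injective in between.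
\<close>

section \<open>Angles, arcs and null sets on the circle\<close>

lemma cis_eq_cis_iff: "cis x = cis y \<longleftrightarrow> (\<exists>k::int. y = x + 2 * pi * k)"
  using sin_cos_eq_iff[of y x] by (auto simp: complex_eq_iff)

lemma cis_add_2pi_int [simp]: "cis (t + 2 * pi * of_int k) = cis t"
  by (metis cis_eq_cis_iff)

lemma cis_Arg_unit_circle: "\<zeta> \<in> unit_circle \<Longrightarrow> cis (Arg \<zeta>) = \<zeta>"
  by (subst cis_Arg) (auto simp: sgn_eq)

lemma unit_circle_eq_cis_image: "unit_circle = range cis"
proof
  show "unit_circle \<subseteq> range cis"
    using cis_Arg_unit_circle by (metis rangeI subsetI)
qed auto

text \<open>The bound \<open>q < p + 2 * pi\<close> makes \<open>q - p\<close> the value that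
  \<open>Arg2pi\<close> picks in [0, 2 pi), so arcs can be handled as images of intervals of
  angles.\<close>

lemma circle_arc_cis:
  assumes "p < q" "q < p + 2 * pi"
  shows "circle_arc (cis p) (cis q) = cis ` {p<..<q}"
proof -
  have "Arg2pi (cis q / cis p) = q - p"
    unfolding cis_divide using assms by (intro Arg2pi_unique[of 1]) (auto simp: cis_conv_exp)
  then have "circle_arc (cis p) (cis q) = {cis (p + t) | t. 0 < t \<and> t < q - p}"
    by (simp add: circle_arc_def cis_mult)
  also have "\<dots> = cis ` {p<..<q}"
    by (force simp: image_iff intro: exI[of _ "_ - p"])
  finally show ?thesis .
qed

text \<open>Derivatives on the circle are defined at the principal argument; as
  \<open>Arg (cis t)\<close> differs from \<open>t\<close> by a period of
  \<open>\<lambda>\<theta>. \<omega> (cis \<theta>)\<close>, they can be read at any angle.\<close>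

lemma circle_DERIV:
  assumes "circle_diff \<omega> (cis t)"
  shows "((\<lambda>\<theta>. \<omega> (cis \<theta>)) has_real_derivative circle_deriv \<omega> (cis t)) (at t)"
proof -
  obtain k :: int where k: "Arg (cis t) = t + 2 * pi * k"
    using cis_eq_cis_iff[of t "Arg (cis t)"] cis_Arg_unit_circle[of "cis t"] by auto
  have "((\<lambda>\<theta>. \<omega> (cis \<theta>)) has_real_derivative circle_deriv \<omega> (cis t)) (at (t + 2 * pi * k))"
    using assms unfolding circle_diff_def circle_deriv_def k
    by (simp add: DERIV_deriv_iff_real_differentiable)
  then show ?thesis
    by (simp add: DERIV_shift)
qed

text \<open>\<open>cis\<close> is injective on [0, 2 pi), so a finite set pulls back to finitely
  many angles, a Lebesgue null set.\<close>

lemma finite_null_circle_measure: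
  assumes "finite F"
  shows "AE \<zeta> in circle_measure. \<zeta> \<notin> F"
proof -
  have meas: "cis \<in> restrict_space lborel {0..<2*pi} \<rightarrow>\<^sub>M restrict_space borel unit_circle"
    by (intro measurable_restrict_space3) (auto intro!: borel_measurable_continuous_onI continuous_intros)
  have F: "{\<zeta> \<in> space (restrict_space borel unit_circle). \<zeta> \<notin> F} \<in> sets (restrict_space borel unit_circle)"
  proof -
    have "unit_circle - F = (- F) \<inter> unit_circle" by auto
    moreover have "- F \<in> sets borel"
      using assms by (intro borel_open) (simp add: finite_imp_closed open_Compl)
    ultimately show ?thesis
      by (auto simp: sets_restrict_space space_restrict_space image_iff set_diff_eq)
  qed
  have "finite {t \<in> {0..<2*pi}. cis t \<in> F}"
  proof (rule finite_imageD)
    show "finite (cis ` {t \<in> {0..<2*pi}. cis t \<in> F})"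
      by (rule finite_subset[OF _ assms]) auto
    show "inj_on cis {t \<in> {0..<2*pi}. cis t \<in> F}"
    proof (rule inj_onI)
      fix x y assume "x \<in> {t \<in> {0..<2*pi}. cis t \<in> F}" "y \<in> {t \<in> {0..<2*pi}. cis t \<in> F}" "cis x = cis y"
      then show "x = y"
        using Arg2pi_unique[of 1 x "cis x"] Arg2pi_unique[of 1 y "cis y"] by (simp add: cis_conv_exp)
    qed
  qed
  then have "AE t in lborel. t \<notin> {t \<in> {0..<2*pi}. cis t \<in> F}"
    by (intro AE_not_in) (simp add: finite_imp_null_set_lborel)
  then have "AE t in restrict_space lborel {0..<2*pi}. cis t \<notin> F"
    by (subst AE_restrict_space_iff) auto
  then show ?thesis
    unfolding circle_measure_def using F by (subst AE_distr_iff[OF meas]) auto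
qed

text \<open>By closedness there is a last point of the complement in \<open>{x..t}\<close> and a
  first one in \<open>{t..y}\<close>; they bound the component of \<open>t\<close> in
  \<open>U\<close>.\<close>

lemma open_gap:
  fixes U :: "real set"
  assumes "open U" "t \<in> U" "x \<notin> U" "x < t" "y \<notin> U" "t < y"
  obtains a b where "a < t" "t < b" "a \<notin> U" "b \<notin> U" "{a<..<b} \<subseteq> U" "x \<le> a" "b \<le> y"
proof -
  have cl: "closed ({x..t} - U)" "closed ({t..y} - U)"
    using assms by auto
  define a where "a = Sup ({x..t} - U)"
  define b where "b = Inf ({t..y} - U)"
  have bdd: "bdd_above ({x..t} - U)" "bdd_below ({t..y} - U)"
    by (auto intro!: bdd_aboveI[of _ t] bdd_belowI[of _ t])
  have "x \<in> {x..t} - U" "y \<in> {t..y} - U" using assms by auto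
  then have a: "a \<in> {x..t} - U" and b: "b \<in> {t..y} - U"
    using closed_contains_Sup[OF _ bdd(1) cl(1)] closed_contains_Inf[OF _ bdd(2) cl(2)]
    unfolding a_def b_def by blast+
  have "s \<in> U" if s: "a < s" "s < b" for s
  proof (rule ccontr)
    assume "s \<notin> U"
    then have "s \<in> {x..t} - U \<or> s \<in> {t..y} - U"
      using a b s by auto
    then show False
      using cSup_upper[OF _ bdd(1)] cInf_lower[OF _ bdd(2)] s unfolding a_def b_def by fastforce
  qed
  moreover have "a \<noteq> t" "b \<noteq> t" using a b assms by auto
  ultimately show ?thesis
    using a b by (intro that[of a b]) auto
qed

lemma at_left_eq_shift: "at_left (t + c) = filtermap (\<lambda>x. x + c) (at_left t)" for t c :: real
  using filtermap_at_left_shift[of "-c" t] by simp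

lemma at_right_eq_shift: "at_right (t + c) = filtermap (\<lambda>x. x + c) (at_right t)" for t c :: real
  using filtermap_at_right_shift[of "-c" t] by simp

section \<open>Periodic predicates with constant one-sided germs\<close>

text \<open>Abstracts the condition \<open>\<omega> (cis s) < l\<close>: it is decided near each
  angle on either side, while its value at the angle itself is unrelated to the two germs.\<close>

locale periodic_germs =
  fixes Q :: "real \<Rightarrow> bool"
  assumes periodic: "Q (t + 2 * pi * of_int k) = Q t"
    and right_germ: "eventually Q (at_right t) \<or> (\<forall>\<^sub>F s in at_right t. \<not> Q s)"
    and left_germ: "eventually Q (at_left t) \<or> (\<forall>\<^sub>F s in at_left t. \<not> Q s)"
begin

text \<open>The filter is punctured: a point where only \<open>Q t\<close> itself fails is included,
  so changing \<open>Q\<close> at isolated points leaves the set unchanged.\<close>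

definition germ_inside :: "real set" where
  "germ_inside = {t. eventually Q (at t)}"

definition enters :: "real set" where
  "enters = {t. (\<forall>\<^sub>F s in at_left t. \<not> Q s) \<and> eventually Q (at_right t)}"

definition leaves :: "real set" where
  "leaves = {t. eventually Q (at_left t) \<and> (\<forall>\<^sub>F s in at_right t. \<not> Q s)}"

lemma shift_germ [simp]:
  "eventually Q (at_left (t + 2 * pi * of_int k)) \<longleftrightarrow> eventually Q (at_left t)"
  "eventually Q (at_right (t + 2 * pi * of_int k)) \<longleftrightarrow> eventually Q (at_right t)"
  "(\<forall>\<^sub>F s in at_left (t + 2 * pi * of_int k). \<not> Q s) \<longleftrightarrow> (\<forall>\<^sub>F s in at_left t. \<not> Q s)"
  "(\<forall>\<^sub>F s in at_right (t + 2 * pi * of_int k). \<not> Q s) \<longleftrightarrow> (\<forall>\<^sub>F s in at_right t. \<not> Q s)"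
  by (simp_all add: at_left_eq_shift at_right_eq_shift eventually_filtermap periodic)

lemma germ_inside_iff: "t \<in> germ_inside \<longleftrightarrow> eventually Q (at_left t) \<and> eventually Q (at_right t)"
  by (simp add: germ_inside_def eventually_at_split)

lemma shift_mem [simp]:
  "t + 2 * pi * of_int k \<in> germ_inside \<longleftrightarrow> t \<in> germ_inside"
  "t + 2 * pi * of_int k \<in> enters \<longleftrightarrow> t \<in> enters"
  "t + 2 * pi * of_int k \<in> leaves \<longleftrightarrow> t \<in> leaves"
  by (simp_all add: germ_inside_iff enters_def leaves_def)

lemma not_both:
  "eventually Q (at_left t) \<Longrightarrow> \<not> (\<forall>\<^sub>F s in at_left t. \<not> Q s)"
  "eventually Q (at_right t) \<Longrightarrow> \<not> (\<forall>\<^sub>F s in at_right t. \<not> Q s)"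
  by (metis (mono_tags, lifting) eventually_mono frequently_def not_eventually trivial_limit_at_left_real
      trivial_limit_at_right_real eventually_frequently)+

lemma disjoint_classes:
  "enters \<inter> germ_inside = {}" "leaves \<inter> germ_inside = {}" "enters \<inter> leaves = {}"
  using not_both by (auto simp: germ_inside_iff enters_def leaves_def)

lemma open_germ_inside: "open germ_inside"
proof (rule openI)
  fix t assume "t \<in> germ_inside"
  then obtain W where W: "open W" "t \<in> W" "\<And>x. x \<in> W \<Longrightarrow> x \<noteq> t \<Longrightarrow> Q x"
    by (auto simp: germ_inside_def eventually_at_topological)
  have "W \<subseteq> germ_inside"
  proof
    fix y assume "y \<in> W"
    show "y \<in> germ_inside"
    proof (cases "y = t")
      case True then show ?thesis using \<open>t \<in> germ_inside\<close> by simp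
    next
      case False
      with W \<open>y \<in> W\<close> show ?thesis
        unfolding germ_inside_def mem_Collect_eq eventually_at_topological
        \<comment> \<open>The point \<open>t\<close> is removed because \<open>Q t\<close> may
          fail.\<close>
        by (intro exI[of _ "W - {t}"]) (auto intro: open_Diff)
    qed
  qed
  then show "\<exists>e>0. ball t e \<subseteq> germ_inside"
    using W by (meson open_contains_ball subset_trans)
qed

lemma Q_right_inside:
  assumes "eventually Q (at_right t)"
  obtains b where "b > t" "{t<..<b} \<subseteq> germ_inside"
proof -
  obtain b where b: "b > t" "\<And>s. t < s \<Longrightarrow> s < b \<Longrightarrow> Q s"
    using assms by (auto simp: eventually_at_right_field)
  have "{t<..<b} \<subseteq> germ_inside"
    using b unfolding germ_inside_def eventually_at_topological
    by (auto intro!: exI[of _ "{t<..<b}"])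
  with b that show ?thesis by blast
qed

lemma Q_left_inside:
  assumes "eventually Q (at_left t)"
  obtains b where "b < t" "{b<..<t} \<subseteq> germ_inside"
proof -
  obtain b where b: "b < t" "\<And>s. b < s \<Longrightarrow> s < t \<Longrightarrow> Q s"
    using assms by (auto simp: eventually_at_left_field)
  have "{b<..<t} \<subseteq> germ_inside"
    using b unfolding germ_inside_def eventually_at_topological
    by (auto intro!: exI[of _ "{b<..<t}"])
  with b that show ?thesis by blast
qed

section \<open>Gaps: intervals between transitions on the line\<close>

lemma gap_endpoints:
  assumes "a < b" "{a<..<b} \<subseteq> germ_inside" "a \<notin> germ_inside" "b \<notin> germ_inside"
  shows "a \<in> enters" "b \<in> leaves"
proof -
  \<comment> \<open>\<open>Q\<close> may fail at single points of the gap, but near each of its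
    points \<open>Q\<close> holds, so \<open>Q\<close> cannot fail throughout a subinterval.\<close>
  have no: "\<not> (\<forall>s. c < s \<and> s < d \<longrightarrow> \<not> Q s)" if "c < d" "{c<..<d} \<subseteq> germ_inside" for c d
  proof
    assume *: "\<forall>s. c < s \<and> s < d \<longrightarrow> \<not> Q s"
    obtain x where x: "c < x" "x < d" using dense[OF \<open>c < d\<close>] by auto
    then have "eventually Q (at_right x)" using that by (auto simp: germ_inside_iff)
    moreover have "\<forall>\<^sub>F s in at_right x. \<not> Q s"
      using * x by (auto simp: eventually_at_right_field intro!: exI[of _ d])
    ultimately show False using not_both by blast
  qed
  have "\<not> (\<forall>\<^sub>F s in at_right a. \<not> Q s)"
  proof
    assume "\<forall>\<^sub>F s in at_right a. \<not> Q s"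
    then obtain c where "c > a" "\<And>s. a < s \<Longrightarrow> s < c \<Longrightarrow> \<not> Q s"
      by (auto simp: eventually_at_right_field)
    then show False using no[of a "min b c"] assms by (auto simp: subset_iff)
  qed
  \<comment> \<open>\<open>Q\<close> holds to the right of \<open>a\<close>; since \<open>a\<close>
    is not inside, the left germ must be the failing one.\<close>
  then show "a \<in> enters"
    using right_germ[of a] left_germ[of a] assms by (auto simp: enters_def germ_inside_iff)
  have "\<not> (\<forall>\<^sub>F s in at_left b. \<not> Q s)"
  proof
    assume "\<forall>\<^sub>F s in at_left b. \<not> Q s"
    then obtain c where "c < b" "\<And>s. c < s \<Longrightarrow> s < b \<Longrightarrow> \<not> Q s"
      by (auto simp: eventually_at_left_field)
    then show False using no[of "max a c" b] assms by (auto simp: subset_iff)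
  qed
  then show "b \<in> leaves"
    using right_germ[of b] left_germ[of b] assms by (auto simp: leaves_def germ_inside_iff)
qed

text \<open>Both ends, being transitions, lie outside \<open>germ_inside\<close>, so a gap is a
  bounded component of that open set.\<close>

definition gap :: "real \<Rightarrow> real \<Rightarrow> bool" where
  "gap a b \<longleftrightarrow> a < b \<and> {a<..<b} \<subseteq> germ_inside \<and> a \<in> enters \<and> b \<in> leaves"

lemma gap_shift: "gap (a + 2 * pi * of_int k) (b + 2 * pi * of_int k) \<longleftrightarrow> gap a b"
proof -
  have "{a + 2 * pi * of_int k<..<b + 2 * pi * of_int k} \<subseteq> germ_inside \<longleftrightarrow> {a<..<b} \<subseteq> germ_inside"
  proof -
    have "{a + 2 * pi * of_int k<..<b + 2 * pi * of_int k} = (\<lambda>x. x + 2 * pi * of_int k) ` {a<..<b}"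
      by (force simp: image_iff intro: bexI[of _ "_ - 2 * pi * of_int k"])
    then show ?thesis by auto
  qed
  then show ?thesis by (simp add: gap_def)
qed

text \<open>The complement is periodic, so a single point \<open>c\<close> outside has translates on
  both sides of \<open>t\<close>, and the component of \<open>t\<close> is bounded.\<close>

lemma gap_exists:
  assumes "t \<in> germ_inside" "c \<notin> germ_inside"
  obtains a b where "gap a b" "a < t" "t < b"
proof -
  define k :: int where "k = \<lfloor>(t - c) / (2 * pi)\<rfloor>"
  have "2 * pi * k \<le> t - c" "t - c < 2 * pi * of_int (k + 1)"
    using floor_divide_lower[of "2 * pi" "t - c"] floor_divide_upper[of "2 * pi" "t - c"]
    by (simp_all add: k_def mult.commute)
  moreover have "c + 2 * pi * of_int k \<notin> germ_inside" "c + 2 * pi * of_int (k + 1) \<notin> germ_inside"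
    using assms by (simp_all only: shift_mem) auto
  moreover from this have "c + 2 * pi * k \<noteq> t" using assms by auto
  ultimately obtain a b where "a < t" "t < b" "a \<notin> germ_inside" "b \<notin> germ_inside" "{a<..<b} \<subseteq> germ_inside"
    using open_gap[OF open_germ_inside assms(1), of "c + 2 * pi * k" "c + 2 * pi * of_int (k + 1)"]
    by (metis add.commute diff_less_eq le_diff_eq order_le_less)
  then show ?thesis
    using gap_endpoints[of a b] that[of a b] by (auto simp: gap_def)
qed

text \<open>The ends of one gap are not inside, hence not within the other gap. Gaps that merely
  touch are excluded because no point both enters and leaves. This is what makes the closures of the
  arcs disjoint.\<close>

lemma gaps_eq:
  assumes "gap a b" "gap a' b'" "{a..b} \<inter> {a'..b'} \<noteq> {}"
  shows "a = a'" "b = b'"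
proof -
  have out: "a \<notin> germ_inside" "b \<notin> germ_inside" "a' \<notin> germ_inside" "b' \<notin> germ_inside" and ne: "a \<noteq> b'" "a' \<noteq> b"
    using assms disjoint_classes by (auto simp: gap_def)
  have sub: "{a<..<b} \<subseteq> germ_inside" "{a'<..<b'} \<subseteq> germ_inside" and lt: "a < b" "a' < b'"
    using assms by (auto simp: gap_def)
  have "a' \<notin> {a<..<b}" "b' \<notin> {a<..<b}" "a \<notin> {a'<..<b'}" "b \<notin> {a'<..<b'}"
    using out sub by blast+
  moreover obtain x where "x \<in> {a..b}" "x \<in> {a'..b'}" using assms by blast
  ultimately show "a = a'" "b = b'"
    using ne lt by auto
qed

text \<open>The translate \<open>a + 2 * pi\<close> enters again, so it is neither within the gap
  nor its leaving end. Strictness keeps the closed gap from wrapping around the circle.\<close>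

lemma gap_length:
  assumes "gap a b"
  shows "b < a + 2 * pi"
proof -
  have "a + 2 * pi * of_int 1 \<in> enters" using assms by (simp only: shift_mem gap_def)
  then have "a + 2 * pi \<in> enters" by simp
  then show ?thesis
    using assms disjoint_classes by (force simp: gap_def)
qed

text \<open>Points slightly to the right of \<open>p\<close> lie in some gap. Its left end cannot
  exceed \<open>p\<close>, since all points just after \<open>p\<close> are inside, nor precede
  \<open>p\<close>, which is itself not inside.\<close>

lemma gap_from_enters:
  assumes "p \<in> enters"
  obtains q where "gap p q"
proof -
  obtain b where b: "b > p" "{p<..<b} \<subseteq> germ_inside"
    using assms Q_right_inside[of p] by (auto simp: enters_def)
  define t where "t = (p + b) / 2"
  have t: "p < t" "t < b" using b by (auto simp: t_def)
  have p: "p \<notin> germ_inside" using assms disjoint_classes by auto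
  obtain a c where g: "gap a c" "a < t" "t < c"
    using gap_exists[of t p] p b t by (metis greaterThanLessThan_iff subsetD)
  have "a \<notin> germ_inside" using g disjoint_classes by (auto simp: gap_def)
  then have "a \<notin> {p<..<b}" using b by blast
  then have "\<not> p < a" using t g by auto
  moreover have "\<not> a < p" using g t p by (auto simp: gap_def subset_iff)
  ultimately show ?thesis using g that by force
qed

lemma gap_to_leaves:
  assumes "q \<in> leaves"
  obtains p where "gap p q"
proof -
  obtain b where b: "b < q" "{b<..<q} \<subseteq> germ_inside"
    using assms Q_left_inside[of q] by (auto simp: leaves_def)
  define t where "t = (b + q) / 2"
  have t: "b < t" "t < q" using b by (auto simp: t_def)
  have q: "q \<notin> germ_inside" using assms disjoint_classes by auto
  obtain a c where g: "gap a c" "a < t" "t < c"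
    using gap_exists[of t q] q b t by (metis greaterThanLessThan_iff subsetD)
  have "c \<notin> germ_inside" using g disjoint_classes by (auto simp: gap_def)
  then have "c \<notin> {b<..<q}" using b by blast
  then have "\<not> c < q" using t g by auto
  moreover have "\<not> q < c" using g t q by (auto simp: gap_def subset_iff)
  ultimately show ?thesis using g that by force
qed

section \<open>Passage to the circle and finiteness of the transitions\<close>

lemma image_cis_period:
  assumes "\<And>t k. t + 2 * pi * of_int k \<in> X \<longleftrightarrow> t \<in> X"
  shows "cis ` X = cis ` (X \<inter> {0..2*pi})"
proof
  show "cis ` X \<subseteq> cis ` (X \<inter> {0..2*pi})"
  proof
    fix z assume "z \<in> cis ` X"
    then obtain t where t: "t \<in> X" "z = cis t" by auto
    define k where "k = - \<lfloor>t / (2 * pi)\<rfloor>"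
    have "0 \<le> t + 2 * pi * k" "t + 2 * pi * k \<le> 2 * pi"
      using floor_divide_lower[of "2 * pi" t] floor_divide_upper[of "2 * pi" t]
      by (simp_all add: k_def algebra_simps)
    then show "z \<in> cis ` (X \<inter> {0..2*pi})"
      using t assms by (intro image_eqI[of _ _ "t + 2 * pi * k"]) auto
  qed
qed auto

text \<open>Serves to keep transitions away from an accumulation point: the interval will lie on one
  side of that point, where the truth value is constant.\<close>

lemma constant_nbhd:
  assumes "c < s" "s < d" "(\<forall>s. c < s \<and> s < d \<longrightarrow> Q s) \<or> (\<forall>s. c < s \<and> s < d \<longrightarrow> \<not> Q s)"
  shows "s \<notin> enters \<union> leaves"
  using assms(3)
proof
  assume "\<forall>s. c < s \<and> s < d \<longrightarrow> Q s"
  then have "eventually Q (at_left s)" "eventually Q (at_right s)"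
    using assms by (force simp: eventually_at_left_field eventually_at_right_field)+
  then show ?thesis using not_both by (auto simp: enters_def leaves_def)
next
  assume "\<forall>s. c < s \<and> s < d \<longrightarrow> \<not> Q s"
  then have "\<forall>\<^sub>F s in at_left s. \<not> Q s" "\<forall>\<^sub>F s in at_right s. \<not> Q s"
    using assms by (force simp: eventually_at_left_field eventually_at_right_field)+
  then show ?thesis using not_both by (auto simp: enters_def leaves_def)
qed

text \<open>By compactness infinitely many transitions in one period would accumulate at some
  \<open>x\<close>, but \<open>Q\<close> is constant just to the left and just to the right of
  \<open>x\<close>.\<close>

lemma finite_transitions: "finite (cis ` enters)" "finite (cis ` leaves)"
proof -
  have "finite ((enters \<union> leaves) \<inter> {0..2*pi})"
  proof (rule ccontr)
    assume "infinite ((enters \<union> leaves) \<inter> {0..2*pi})"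
    then obtain x where x: "x islimpt ((enters \<union> leaves) \<inter> {0..2*pi})"
      using compact_eq_Bolzano_Weierstrass[of "{0..2*pi}"] by (metis compact_Icc inf_le2)
    have right: "\<forall>\<^sub>F s in at_right x. s \<notin> enters \<union> leaves"
    proof -
      obtain b where b: "b > x" "(\<forall>s. x < s \<and> s < b \<longrightarrow> Q s) \<or> (\<forall>s. x < s \<and> s < b \<longrightarrow> \<not> Q s)"
        using right_germ[of x] by (auto simp: eventually_at_right_field)
      have "s \<notin> enters \<union> leaves" if "x < s" "s < b" for s
        using constant_nbhd[OF that b(2)] .
      with b show ?thesis by (auto simp: eventually_at_right_field)
    qed
    have left: "\<forall>\<^sub>F s in at_left x. s \<notin> enters \<union> leaves"
    proof -
      obtain b where b: "b < x" "(\<forall>s. b < s \<and> s < x \<longrightarrow> Q s) \<or> (\<forall>s. b < s \<and> s < x \<longrightarrow> \<not> Q s)"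
        using left_germ[of x] by (auto simp: eventually_at_left_field)
      have "s \<notin> enters \<union> leaves" if "b < s" "s < x" for s
        using constant_nbhd[OF that b(2)] .
      with b show ?thesis by (auto simp: eventually_at_left_field)
    qed
    from left right have "\<forall>\<^sub>F s in at x. s \<notin> enters \<union> leaves"
      by (simp add: eventually_at_split)
    then have "\<forall>\<^sub>F s in at x. s \<notin> (enters \<union> leaves) \<inter> {0..2*pi}"
      by eventually_elim auto
    with x show False by (simp add: islimpt_iff_eventually)
  qed
  then have "finite (enters \<inter> {0..2*pi})" "finite (leaves \<inter> {0..2*pi})"
    by (auto elim!: rev_finite_subset)
  then show "finite (cis ` enters)" "finite (cis ` leaves)"
    by (subst image_cis_period; simp)+
qed

text \<open>Equal points of the circle come from angles that differ by a multiple of the period;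
  shifting one gap by it reduces the claim to the line.\<close>

lemma gap_unique_circle:
  assumes "gap a b" "gap a' b'" "x \<in> {a..b}" "x' \<in> {a'..b'}" "cis x = cis x'"
  shows "cis a = cis a'" "cis b = cis b'"
proof -
  obtain k :: int where k: "x' = x + 2 * pi * k"
    using assms cis_eq_cis_iff by blast
  have "gap (a + 2 * pi * k) (b + 2 * pi * k)"
    using assms gap_shift by blast
  moreover have "x' \<in> {a + 2 * pi * k..b + 2 * pi * k} \<inter> {a'..b'}"
    using assms k by auto
  ultimately have "a' = a + 2 * pi * k" "b' = b + 2 * pi * k"
    using gaps_eq assms by blast+
  then show "cis a = cis a'" "cis b = cis b'" by simp_all
qed

text \<open>Each entering point starts one gap and each leaving point ends one. Enumerating the gaps
  by their left ends yields the arcs, and their right ends show that the circle has as many leaving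
  as entering points. The first assumption rules out the full circle, which is no union of finitely
  many such arcs with disjoint closures.\<close>

lemma germ_inside_arcs:
  assumes "germ_inside \<noteq> UNIV" "card (cis ` enters) = m"
  obtains \<alpha> \<beta> :: "nat \<Rightarrow> complex" where
    "\<And>j. j \<in> {1..m} \<Longrightarrow> \<alpha> j \<in> unit_circle \<and> \<beta> j \<in> unit_circle \<and> \<alpha> j \<noteq> \<beta> j"
    "disjoint_family_on (\<lambda>j. closure (circle_arc (\<alpha> j) (\<beta> j))) {1..m}"
    "(\<Union>j\<in>{1..m}. circle_arc (\<alpha> j) (\<beta> j)) = cis ` germ_inside"
    "card (cis ` leaves) = m"
proof -
  obtain \<alpha> where \<alpha>: "bij_betw \<alpha> {1..m} (cis ` enters)"
    using ex_bij_betw_nat_finite_1[OF finite_transitions(1)] assms(2) by auto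
  have "\<exists>p q. gap p q \<and> \<alpha> j = cis p" if "j \<in> {1..m}" for j
    using bij_betwE[OF \<alpha>] that gap_from_enters by (metis imageE)
  then obtain p q where pq: "\<And>j. j \<in> {1..m} \<Longrightarrow> gap (p j) (q j)" "\<And>j. j \<in> {1..m} \<Longrightarrow> \<alpha> j = cis (p j)"
    by metis
  define \<beta> where "\<beta> = (\<lambda>j. cis (q j))"
  have lt: "p j < q j" if "j \<in> {1..m}" for j using pq that by (auto simp: gap_def)
  have arc: "circle_arc (\<alpha> j) (\<beta> j) = cis ` {p j<..<q j}" if "j \<in> {1..m}" for j
    using circle_arc_cis[OF lt[OF that] gap_length[OF pq(1)[OF that]]] that by (simp add: \<beta>_def pq)
  \<comment> \<open>Stated for closed intervals, so that it serves both the disjointness of the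
    closures and the injectivity of \<open>\<beta>\<close>.\<close>
  have same: "i = j" if "i \<in> {1..m}" "j \<in> {1..m}" "x \<in> {p i..q i}" "x' \<in> {p j..q j}" "cis x = cis x'"
    for i j x x'
  proof -
    have "\<alpha> i = \<alpha> j"
      using gap_unique_circle(1)[OF pq(1) pq(1) that(3-5)] that pq by auto
    then show ?thesis using bij_betw_imp_inj_on[OF \<alpha>] that by (metis inj_onD)
  qed
  have clos: "closure (circle_arc (\<alpha> j) (\<beta> j)) \<subseteq> cis ` {p j..q j}" if "j \<in> {1..m}" for j
  proof (rule closure_minimal)
    show "circle_arc (\<alpha> j) (\<beta> j) \<subseteq> cis ` {p j..q j}"
      unfolding arc[OF that] by (intro image_mono) auto
    show "closed (cis ` {p j..q j})"
      by (intro compact_imp_closed compact_continuous_image continuous_intros) auto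
  qed
  have "disjoint_family_on (\<lambda>j. closure (circle_arc (\<alpha> j) (\<beta> j))) {1..m}"
  proof (unfold disjoint_family_on_def, intro ballI impI equals0I)
    fix i j z assume ij: "i \<in> {1..m}" "j \<in> {1..m}" "i \<noteq> j"
      and "z \<in> closure (circle_arc (\<alpha> i) (\<beta> i)) \<inter> closure (circle_arc (\<alpha> j) (\<beta> j))"
    then obtain x x' where x: "x \<in> {p i..q i}" "x' \<in> {p j..q j}" "z = cis x" "z = cis x'"
      using clos by blast
    then show False using same[OF ij(1,2) x(1,2)] ij(3) by simp
  qed
  moreover have "(\<Union>j\<in>{1..m}. circle_arc (\<alpha> j) (\<beta> j)) = cis ` germ_inside"
  proof
    show "(\<Union>j\<in>{1..m}. circle_arc (\<alpha> j) (\<beta> j)) \<subseteq> cis ` germ_inside"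
    proof (rule UN_least)
      fix j assume j: "j \<in> {1..m}"
      then have "{p j<..<q j} \<subseteq> germ_inside" using pq(1) by (simp add: gap_def)
      then show "circle_arc (\<alpha> j) (\<beta> j) \<subseteq> cis ` germ_inside" unfolding arc[OF j] by (rule image_mono)
    qed
    show "cis ` germ_inside \<subseteq> (\<Union>j\<in>{1..m}. circle_arc (\<alpha> j) (\<beta> j))"
    proof
      fix z assume "z \<in> cis ` germ_inside"
      then obtain t where t: "t \<in> germ_inside" "z = cis t" by auto
      obtain c where "c \<notin> germ_inside" using assms by auto
      with t obtain a b where ab: "gap a b" "a < t" "t < b" using gap_exists by blast
      then have "cis a \<in> cis ` enters" by (auto simp: gap_def)
      then obtain j where j: "j \<in> {1..m}" "\<alpha> j = cis a"
        using \<alpha> by (metis bij_betw_imp_surj_on imageE)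
      \<comment> \<open>The gap around \<open>t\<close> and the chosen gap with index
        \<open>j\<close> agree only up to a shift by a multiple of the period.\<close>
      obtain k :: int where k: "p j = a + 2 * pi * k"
        using pq(2)[OF j(1)] j(2) cis_eq_cis_iff by metis
      have g: "gap (p j) (b + 2 * pi * k)" using ab(1) gap_shift k by simp
      have "q j = b + 2 * pi * k"
        using gaps_eq(2)[OF pq(1)[OF j(1)] g] lt[OF j(1)] g by (auto simp: gap_def)
      then have "t + 2 * pi * k \<in> {p j<..<q j}" using k ab by simp
      then have "cis (t + 2 * pi * k) \<in> circle_arc (\<alpha> j) (\<beta> j)"
        unfolding arc[OF j(1)] by (rule imageI)
      then show "z \<in> (\<Union>j\<in>{1..m}. circle_arc (\<alpha> j) (\<beta> j))"
        using t(2) j(1) unfolding cis_add_2pi_int by blast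
    qed
  qed
  moreover have "card (cis ` leaves) = m"
  proof -
    have "bij_betw \<beta> {1..m} (cis ` leaves)"
    proof (rule bij_betw_imageI)
      show "inj_on \<beta> {1..m}"
      proof (rule inj_onI)
        fix i j assume "i \<in> {1..m}" "j \<in> {1..m}" "\<beta> i = \<beta> j"
        then show "i = j"
          using same[of i j "q i" "q j"] lt[of i] lt[of j] by (auto simp: \<beta>_def)
      qed
      have "\<beta> ` {1..m} \<subseteq> cis ` leaves" using pq by (auto simp: \<beta>_def gap_def)
      moreover have "cis b \<in> \<beta> ` {1..m}" if "b \<in> leaves" for b
      proof -
        obtain a where a: "gap a b" using gap_to_leaves \<open>b \<in> leaves\<close> by blast
        then have "cis a \<in> cis ` enters" by (auto simp: gap_def)
        then obtain j where j: "j \<in> {1..m}" "\<alpha> j = cis a"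
          using \<alpha> by (metis bij_betw_imp_surj_on imageE)
        have "cis (q j) = cis b"
          using gap_unique_circle(2)[OF pq(1)[OF j(1)] a, of "p j" a] j pq lt[OF j(1)] a
          by (auto simp: gap_def)
        then show ?thesis using imageI[OF j(1), of \<beta>] by (simp add: \<beta>_def)
      qed
      ultimately show "\<beta> ` {1..m} = cis ` leaves" by auto
    qed
    then show ?thesis by (metis bij_betw_same_card card_atLeastAtMost diff_Suc_1)
  qed
  moreover have "\<alpha> j \<in> unit_circle \<and> \<beta> j \<in> unit_circle \<and> \<alpha> j \<noteq> \<beta> j" if j: "j \<in> {1..m}" for j
  proof -
    have "\<alpha> j \<noteq> \<beta> j"
    proof
      \<comment> \<open>Then \<open>q j\<close> would be a translate of \<open>p j\<close>, hence
        entering as well as leaving.\<close>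
      assume "\<alpha> j = \<beta> j"
      then obtain k :: int where k: "q j = p j + 2 * pi * k"
        using pq(2)[OF j] cis_eq_cis_iff by (metis \<beta>_def)
      then have "q j \<in> enters"
        using pq(1)[OF j] by (auto simp: gap_def)
      then show False
        using pq(1)[OF j] disjoint_classes by (auto simp: gap_def)
    qed
    then show ?thesis using pq(2)[OF j] by (simp add: \<beta>_def)
  qed
  ultimately show ?thesis using that by blast
qed

end

section \<open>Piecewise smooth functions on the circle\<close>

lemma cis_mem_image_periodic:
  assumes "\<And>t k. t + 2 * pi * of_int k \<in> X \<longleftrightarrow> t \<in> X"
  shows "cis t \<in> cis ` X \<longleftrightarrow> t \<in> X"
  using assms by (metis cis_eq_cis_iff imageE imageI)

locale regular_interval =
  fixes \<omega> :: "complex \<Rightarrow> real" and S :: "complex set" and l1 l2 :: real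
  assumes finite_S: "finite S"
    and S_circle: "S \<subseteq> unit_circle"
    and C1: "circle_C1_on (unit_circle - S) \<omega>"
    and one_sided: "\<forall>\<eta>\<in>S. has_one_sided_limits \<omega> \<eta>"
    and l1_less_l2: "l1 < l2"
    and regular: "{l1<..<l2} \<inter> Lambda_exc \<omega> S = {}"
begin

abbreviation f :: "real \<Rightarrow> real" where
  "f \<theta> \<equiv> \<omega> (cis \<theta>)"

definition W :: "complex set" where
  "W = {\<zeta> \<in> unit_circle - S. \<omega> \<zeta> \<in> {l1<..<l2}}"

lemma cis_in_W: "cis t \<in> W \<longleftrightarrow> cis t \<notin> S \<and> f t \<in> {l1<..<l2}"
  by (auto simp: W_def)

lemma f_DERIV:
  assumes "cis t \<notin> S"
  shows "(f has_real_derivative circle_deriv \<omega> (cis t)) (at t)"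
  using assms C1 by (intro circle_DERIV) (auto simp: circle_C1_on_def)

lemma f_isCont: "cis t \<notin> S \<Longrightarrow> isCont f t"
  using f_DERIV DERIV_isCont by blast

lemma deriv_nonzero: "\<zeta> \<in> W \<Longrightarrow> circle_deriv \<omega> \<zeta> \<noteq> 0"
  using regular by (auto simp: W_def Lambda_exc_def Lambda_cr_def)

lemma tendsto_lim_plus:
  assumes "cis t \<in> S"
  shows "(f \<longlongrightarrow> lim_plus \<omega> (cis t)) (at_right t)"
proof -
  obtain l where "((\<lambda>\<epsilon>. \<omega> (cis t * cis \<epsilon>)) \<longlongrightarrow> l) (at_right 0)"
    using one_sided assms by (auto simp: has_one_sided_limits_def)
  then have "((\<lambda>\<epsilon>. \<omega> (cis t * cis \<epsilon>)) \<longlongrightarrow> lim_plus \<omega> (cis t)) (at_right 0)"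
    unfolding lim_plus_def by (simp add: tendsto_Lim)
  then show ?thesis
    by (subst filterlim_at_right_to_0) (simp add: cis_mult add.commute)
qed

lemma tendsto_lim_minus:
  assumes "cis t \<in> S"
  shows "(f \<longlongrightarrow> lim_minus \<omega> (cis t)) (at_left t)"
proof -
  obtain l where "((\<lambda>\<epsilon>. \<omega> (cis t * cis \<epsilon>)) \<longlongrightarrow> l) (at_left 0)"
    using one_sided assms by (auto simp: has_one_sided_limits_def)
  then have "((\<lambda>\<epsilon>. \<omega> (cis t * cis \<epsilon>)) \<longlongrightarrow> lim_minus \<omega> (cis t)) (at_left 0)"
    unfolding lim_minus_def by (simp add: tendsto_Lim)
  then show ?thesis
    using at_left_eq_shift[of 0 t] by (simp add: filterlim_filtermap cis_mult add.commute)
qed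

lemma lim_not_in:
  assumes "\<eta> \<in> S"
  shows "lim_plus \<omega> \<eta> \<notin> {l1<..<l2}" "lim_minus \<omega> \<eta> \<notin> {l1<..<l2}"
  using assms regular by (auto simp: Lambda_exc_def Lambda_thr_def)

text \<open>At a point of \<open>S\<close> both limits are threshold values; at any other point
  outside \<open>W\<close> both equal \<open>f t\<close> by continuity. Either way they avoid the
  interval.\<close>

lemma boundary_limits:
  assumes "cis t \<notin> W"
  obtains L L' where "(f \<longlongrightarrow> L) (at_right t)" "L \<notin> {l1<..<l2}" "(f \<longlongrightarrow> L') (at_left t)" "L' \<notin> {l1<..<l2}"
proof (cases "cis t \<in> S")
  case True
  then show ?thesis
    using that tendsto_lim_plus tendsto_lim_minus lim_not_in by blast
next
  case False
  then have "f t \<notin> {l1<..<l2}" using assms cis_in_W by blast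
  moreover have "(f \<longlongrightarrow> f t) (at_right t)" "(f \<longlongrightarrow> f t) (at_left t)"
    using f_isCont[OF False] by (auto simp: isCont_def filterlim_at_split)
  ultimately show ?thesis using that by blast
qed

section \<open>Components of the preimage of the interval\<close>

lemma open_cis_W: "open (cis -` W)"
proof -
  have "open (cis -` (- S))"
    using finite_S by (intro open_vimage continuous_intros) (simp add: finite_imp_closed open_Compl)
  moreover have "continuous_on (cis -` (- S)) f"
    using f_isCont by (auto intro!: continuous_at_imp_continuous_on)
  ultimately have "open (cis -` (- S) \<inter> f -` {l1<..<l2})"
    by (intro continuous_open_preimage) auto
  also have "cis -` (- S) \<inter> f -` {l1<..<l2} = cis -` W"
    by (auto simp: cis_in_W)
  finally show ?thesis .
qed

text \<open>At an endpoint in S the value of f is arbitrary; g replaces it by the one-sided limit.\<close>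
lemma no_equal_values:
  assumes "x < y" "{x<..<y} \<subseteq> cis -` W" "continuous_on {x..y} g" "g x = g y"
    and "\<And>s. s \<in> {x<..<y} \<Longrightarrow> g s = f s"
  shows False
proof -
  have D: "(g has_real_derivative circle_deriv \<omega> (cis s)) (at s)" if "s \<in> {x<..<y}" for s
  proof -
    have "cis s \<in> W" using that assms(2) by blast
    then have "(f has_real_derivative circle_deriv \<omega> (cis s)) (at s)"
      by (intro f_DERIV) (simp add: cis_in_W)
    then show ?thesis
      by (rule has_field_derivative_transform_within_open[of _ _ _ "{x<..<y}"])
        (use that assms(5) in auto)
  qed
  then obtain z where z: "x < z" "z < y" "(g has_real_derivative 0) (at z)"
    using Rolle[OF assms(1,4,3)] by (force simp: real_differentiable_def)
  then have "circle_deriv \<omega> (cis z) = 0"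
    using D[of z] DERIV_unique by fastforce
  moreover have "cis z \<in> W" using z assms(2) by auto
  ultimately show False using deriv_nonzero by blast
qed

text \<open>Otherwise \<open>f\<close> would have a nonzero derivative everywhere, against Rolle's
  theorem and \<open>f 0 = f (2 * pi)\<close>.\<close>

lemma not_all_W: "\<exists>c. cis c \<notin> W"
proof (rule ccontr)
  assume "\<not> (\<exists>c. cis c \<notin> W)"
  then have all: "cis c \<in> W" for c by blast
  then have "continuous_on {0..2*pi} f"
    using f_isCont cis_in_W by (auto intro!: continuous_at_imp_continuous_on)
  then show False
    using no_equal_values[of 0 "2 * pi" f] all by auto
qed

text \<open>Again the translates of a point outside \<open>W\<close> bracket \<open>t\<close>. The
  length bound is not strict, since \<open>W\<close> may be the circle without a single
  point.\<close>

lemma W_gap: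
  assumes "cis t \<in> W"
  obtains a b where "a < t" "t < b" "cis a \<notin> W" "cis b \<notin> W" "{a<..<b} \<subseteq> cis -` W" "b \<le> a + 2 * pi"
proof -
  obtain c where c: "cis c \<notin> W" using not_all_W by blast
  define k :: int where "k = \<lfloor>(t - c) / (2 * pi)\<rfloor>"
  have k: "2 * pi * k \<le> t - c" "t - c < 2 * pi * of_int (k + 1)"
    using floor_divide_lower[of "2 * pi" "t - c"] floor_divide_upper[of "2 * pi" "t - c"]
    by (simp_all add: k_def mult.commute)
  have out: "c + 2 * pi * of_int k \<notin> cis -` W" "c + 2 * pi * of_int (k + 1) \<notin> cis -` W"
    using c by (simp_all only: vimage_eq cis_add_2pi_int not_False_eq_True)
  have "t \<in> cis -` W" using assms by simp
  then have "c + 2 * pi * of_int k \<noteq> t" using out(1) by metis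
  then have "c + 2 * pi * of_int k < t" "t < c + 2 * pi * of_int (k + 1)"
    using k by linarith+
  then obtain a b where ab: "a < t" "t < b" "a \<notin> cis -` W" "b \<notin> cis -` W" "{a<..<b} \<subseteq> cis -` W"
    using open_gap[OF open_cis_W \<open>t \<in> cis -` W\<close> out(1) _ out(2)] by metis
  have "a + 2 * pi \<notin> cis -` W" using ab cis_add_2pi_int[of a 1] by simp
  then have "a + 2 * pi \<notin> {a<..<b}" using ab(5) by blast
  then have "b \<le> a + 2 * pi" by auto
  then show ?thesis using ab that by auto
qed

text \<open>For maximality, a connected part of \<open>W\<close> cannot leave the arc: the closed
  arc and the complementary closed arc share only end points, and these lie outside
  \<open>W\<close>.\<close>

lemma component_gap:
  assumes "cis t \<in> W" "a < t" "t < b" "cis a \<notin> W" "cis b \<notin> W" "{a<..<b} \<subseteq> cis -` W" "b \<le> a + 2 * pi"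
  shows "connected_component_set W (cis t) = cis ` {a<..<b}"
proof (rule connected_component_unique)
  show "connected (cis ` {a<..<b})"
    by (intro connected_continuous_image continuous_intros) auto
next
  fix D assume D: "cis t \<in> D" "D \<subseteq> W" "connected D"
  \<comment> \<open>The circle is the union of the closed arcs K1 and K2, whose common points are outside W.\<close>
  define K1 where "K1 = cis ` {a..b}"
  define K2 where "K2 = cis ` {b..a + 2 * pi}"
  have closed: "closed K1" "closed K2"
    unfolding K1_def K2_def
    by (intro compact_imp_closed compact_continuous_image continuous_intros; simp)+
  have "z \<in> K1 \<union> K2" if z: "z \<in> unit_circle" for z
  proof -
    obtain s where s: "z = cis s" using z unfolding unit_circle_eq_cis_image by auto
    define k where "k = - \<lfloor>(s - a) / (2 * pi)\<rfloor>"
    have "a \<le> s + 2 * pi * k" "s + 2 * pi * k \<le> a + 2 * pi"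
      using floor_divide_lower[of "2 * pi" "s - a"] floor_divide_upper[of "2 * pi" "s - a"]
      by (simp_all add: k_def algebra_simps)
    then have "s + 2 * pi * k \<in> {a..b} \<union> {b..a + 2 * pi}" by auto
    then have "cis (s + 2 * pi * k) \<in> K1 \<union> K2" unfolding K1_def K2_def by blast
    then show ?thesis using s by simp
  qed
  then have sub: "D \<subseteq> K1 \<union> K2" using D by (auto simp: W_def)
  \<comment> \<open>The angle \<open>a + 2 * pi\<close> occurs as the far end of
    \<open>K2\<close>.\<close>
  have interior: "x \<noteq> a \<and> x \<noteq> b \<and> x \<noteq> a + 2 * pi" if "cis x \<in> W" for x
    using that assms(4,5) cis_add_2pi_int[of a 1] by auto
  have "K1 \<inter> K2 \<inter> W = {}"
  proof (rule equals0I)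
    fix z assume z: "z \<in> K1 \<inter> K2 \<inter> W"
    then obtain x y where xy: "x \<in> {a..b}" "y \<in> {b..a + 2 * pi}" "z = cis x" "z = cis y"
      by (auto simp: K1_def K2_def)
    obtain k :: int where k: "y = x + 2 * pi * k" using xy cis_eq_cis_iff by metis
    have "x \<noteq> a \<and> x \<noteq> b" "y \<noteq> b \<and> y \<noteq> a + 2 * pi" using z xy interior by blast+
    \<comment> \<open>\<open>x\<close> comes before \<open>b\<close> and \<open>y\<close> after it,
      within one turn, so the integer \<open>k\<close> would lie strictly between 0 and 1.\<close>
    with xy have "0 < y - x" "y - x < 2 * pi * 1" by auto
    then have "0 < real_of_int k" "real_of_int k < 1"
      using k by (simp_all add: zero_less_mult_iff)
    then show False by simp
  qed
  then have "K1 \<inter> D = {} \<or> K2 \<inter> D = {}"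
    using connected_closedD[OF D(3) _ sub closed] D(2) by blast
  moreover have "cis t \<in> K1" using assms by (auto simp: K1_def)
  ultimately have "D \<subseteq> K1 \<inter> W" using D sub by blast
  also have "\<dots> \<subseteq> cis ` {a<..<b}"
    using interior by (force simp: K1_def)
  finally show "D \<subseteq> cis ` {a<..<b}" .
qed (use assms in auto)

text \<open>The limits at the two ends are limits of values in the interval yet avoid it, so each is
  \<open>l1\<close> or \<open>l2\<close>; Rolle's theorem makes them different, and every level in
  between is attained.\<close>

lemma gap_level_exists:
  assumes "a < b" "cis a \<notin> W" "cis b \<notin> W" "{a<..<b} \<subseteq> cis -` W" "l \<in> {l1<..<l2}"
  shows "\<exists>s\<in>{a<..<b}. f s = l"
proof -
  obtain A where A: "(f \<longlongrightarrow> A) (at_right a)" "A \<notin> {l1<..<l2}"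
    using boundary_limits[OF assms(2)] by metis
  obtain B where B: "(f \<longlongrightarrow> B) (at_left b)" "B \<notin> {l1<..<l2}"
    using boundary_limits[OF assms(3)] by metis
  have in_W: "f s \<in> {l1<..<l2}" if "a < s" "s < b" for s
    using assms(4) that cis_in_W by auto
  have "\<forall>\<^sub>F s in at_right a. l1 \<le> f s \<and> f s \<le> l2"
    unfolding eventually_at_right_field using assms(1) in_W by (intro exI[of _ b]) (auto simp: less_imp_le)
  moreover have "\<forall>\<^sub>F s in at_left b. l1 \<le> f s \<and> f s \<le> l2"
    unfolding eventually_at_left_field using assms(1) in_W by (intro exI[of _ a]) (auto simp: less_imp_le)
  ultimately have "l1 \<le> A" "A \<le> l2" "l1 \<le> B" "B \<le> l2"
    using tendsto_lowerbound[OF A(1), of l1] tendsto_upperbound[OF A(1), of l2]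
      tendsto_lowerbound[OF B(1), of l1] tendsto_upperbound[OF B(1), of l2]
    by (simp_all add: eventually_conj_iff)
  then have AB: "A = l1 \<or> A = l2" "B = l1 \<or> B = l2" using A B by auto
  \<comment> \<open>The ends may belong to \<open>S\<close>, where the value of \<open>f\<close> is
    arbitrary; with the one-sided limits as end values the function becomes continuous on the closed
    interval.\<close>
  define g where "g = (\<lambda>s. if s \<le> a then A else if s \<ge> b then B else f s)"
  have g: "g s = f s" if "s \<in> {a<..<b}" for s using that by (simp add: g_def)
  have cont: "continuous_on {a..b} g"
  proof (rule continuous_on_IccI)
    show "(g \<longlongrightarrow> g a) (at_right a)"
      using assms(1) A(1)
      by (subst filterlim_cong[OF refl refl, of _ f])
        (auto simp: eventually_at_right_field g_def intro!: exI[of _ b])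
    show "(g \<longlongrightarrow> g b) (at_left b)"
      using assms(1) B(1)
      by (subst filterlim_cong[OF refl refl, of _ f])
        (auto simp: eventually_at_left_field g_def intro!: exI[of _ a])
    fix s assume s: "a < s" "s < b"
    then have "cis s \<notin> S" using assms(4) cis_in_W by auto
    then have "(f \<longlongrightarrow> g s) (at s)" using f_isCont s by (simp add: isCont_def g)
    moreover have "\<forall>\<^sub>F x in at s. g x = f x"
      using s g unfolding eventually_at_topological by (intro exI[of _ "{a<..<b}"]) auto
    ultimately show "g \<midarrow>s\<rightarrow> g s" by (simp add: filterlim_cong)
  qed (use assms in auto)
  have ends: "g a = A" "g b = B" using assms(1) by (simp_all add: g_def)
  have "A \<noteq> B"
    using no_equal_values[OF assms(1,4) cont] ends g by auto
  with AB l1_less_l2 assms(5) have "A < l \<and> l < B \<or> B < l \<and> l < A" by auto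
  then obtain s where s: "a \<le> s" "s \<le> b" "g s = l"
    using IVT'[of g a l b] IVT2'[of g b l a] ends cont assms(1) by (auto simp: less_imp_le)
  with ends \<open>A < l \<and> l < B \<or> B < l \<and> l < A\<close> have "s \<noteq> a" "s \<noteq> b" by auto
  with s have "s \<in> {a<..<b}" by simp
  then show ?thesis using s g by auto
qed

text \<open>Existence is the intermediate value argument on the gap of the component; uniqueness is
  Rolle's theorem between two points with the same value.\<close>

lemma component_level_unique:
  assumes "C \<in> components W" "l \<in> {l1<..<l2}"
  shows "\<exists>!\<zeta>. \<zeta> \<in> C \<and> \<omega> \<zeta> = l"
proof -
  obtain \<zeta> where \<zeta>: "\<zeta> \<in> W" "C = connected_component_set W \<zeta>"
    using assms by (auto simp: components_def)
  then obtain t where t: "cis t \<in> W" "C = connected_component_set W (cis t)"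
    by (metis W_def cis_Arg_unit_circle DiffD1 mem_Collect_eq)
  obtain a b where ab: "a < t" "t < b" "cis a \<notin> W" "cis b \<notin> W" "{a<..<b} \<subseteq> cis -` W" "b \<le> a + 2 * pi"
    using W_gap[OF t(1)] .
  have C: "C = cis ` {a<..<b}" using component_gap[OF t(1) ab] t by simp
  have no: False if "x \<in> {a<..<b}" "y \<in> {a<..<b}" "x < y" "f x = f y" for x y
  proof -
    have "{x..y} \<subseteq> cis -` W" using that ab(5) by auto
    moreover from this have "continuous_on {x..y} f"
      using f_isCont cis_in_W by (auto intro!: continuous_at_imp_continuous_on)
    ultimately show False
      using no_equal_values[of x y f] that by force
  qed
  obtain s where s: "s \<in> {a<..<b}" "f s = l"
    using gap_level_exists[of a b l] ab assms by auto
  then show ?thesis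
  proof (intro ex1I[of _ "cis s"])
    fix z assume "z \<in> C \<and> \<omega> z = l"
    then obtain x where x: "x \<in> {a<..<b}" "z = cis x" "f x = l" unfolding C by blast
    then show "z = cis s"
      using no[of x s] no[of s x] s by (metis linorder_neqE_linordered_idom)
  qed (use s C in auto)
qed

section \<open>Counting components by their points at a level\<close>

lemma component_sign:
  assumes "C \<in> components W" "\<zeta> \<in> C" "\<sigma> * circle_deriv \<omega> \<zeta> > 0" "z \<in> C"
  shows "\<sigma> * circle_deriv \<omega> z > 0"
proof (rule ccontr)
  assume neg: "\<not> \<sigma> * circle_deriv \<omega> z > 0"
  have sub: "C \<subseteq> W" and conn: "connected C"
    using assms in_components_subset in_components_connected by blast+
  have "continuous_on (unit_circle - S) (circle_deriv \<omega>)"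
    using C1 by (simp add: circle_C1_on_def)
  then have "continuous_on C (circle_deriv \<omega>)"
    by (rule continuous_on_subset) (use sub in \<open>auto simp: W_def\<close>)
  \<comment> \<open>A sign change on the connected set \<open>C\<close> would force a zero of the
    derivative, and \<open>W\<close> contains none.\<close>
  then have "connected ((\<lambda>z. \<sigma> * circle_deriv \<omega> z) ` C)"
    by (intro connected_continuous_image conn continuous_intros)
  then have "0 \<in> (\<lambda>z. \<sigma> * circle_deriv \<omega> z) ` C"
    by (rule connectedD_interval[of _ "\<sigma> * circle_deriv \<omega> z" "\<sigma> * circle_deriv \<omega> \<zeta>"])
      (use assms neg in auto)
  then obtain y where "y \<in> C" "\<sigma> * circle_deriv \<omega> y = 0" by auto
  moreover have "\<sigma> \<noteq> 0" using assms by auto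
  ultimately show False using deriv_nonzero sub by auto
qed

text \<open>The minus sign follows the convention of \<open>n_count\<close>:
  \<open>\<sigma> = 1\<close> selects the downward crossings, where \<open>f\<close> enters the
  sublevel set as the angle grows, and \<open>\<sigma> = -1\<close> the upward ones.\<close>

definition level :: "real \<Rightarrow> real \<Rightarrow> complex set" where
  "level \<sigma> l = {\<zeta> \<in> unit_circle - S. \<omega> \<zeta> = l \<and> - \<sigma> * circle_deriv \<omega> \<zeta> > 0}"

lemma level_subset_W: "l \<in> {l1<..<l2} \<Longrightarrow> level \<sigma> l \<subseteq> W"
  by (auto simp: level_def W_def)

text \<open>Each component has exactly one point at height \<open>l\<close>, and the sign of the
  derivative there is its sign on the whole component. In particular the number of such points does
  not depend on \<open>l\<close>.\<close>

lemma card_level: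
  assumes "l \<in> {l1<..<l2}"
  shows "n_count \<sigma> \<omega> S {l1<..<l2} = card (level \<sigma> l)"
proof -
  have arcs: "preimage_arcs \<omega> S {l1<..<l2} = components W"
    by (simp add: preimage_arcs_def W_def)
  have mem: "\<zeta> \<in> connected_component_set W \<zeta>" "connected_component_set W \<zeta> \<in> components W"
    if "\<zeta> \<in> level \<sigma> l" for \<zeta>
    using that level_subset_W[OF assms, of \<sigma>] by (auto intro: componentsI)
  have "bij_betw (connected_component_set W) (level \<sigma> l)
    {C \<in> components W. \<forall>\<zeta>\<in>C. - \<sigma> * circle_deriv \<omega> \<zeta> > 0}"
  proof (rule bij_betw_imageI)
    show "inj_on (connected_component_set W) (level \<sigma> l)"
    proof (rule inj_onI)
      fix x y assume xy: "x \<in> level \<sigma> l" "y \<in> level \<sigma> l"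
        "connected_component_set W x = connected_component_set W y"
      then have "\<omega> x = l" "\<omega> y = l" by (auto simp: level_def)
      then show "x = y"
        using component_level_unique[OF mem(2)[OF xy(1)] assms] mem(1) xy by metis
    qed
    show "connected_component_set W ` level \<sigma> l
      = {C \<in> components W. \<forall>\<zeta>\<in>C. - \<sigma> * circle_deriv \<omega> \<zeta> > 0}"
    proof (intro equalityI subsetI)
      fix C assume "C \<in> connected_component_set W ` level \<sigma> l"
      then obtain \<zeta> where \<zeta>: "\<zeta> \<in> level \<sigma> l" "C = connected_component_set W \<zeta>" by blast
      then have "- \<sigma> * circle_deriv \<omega> \<zeta> > 0" by (simp add: level_def)
      then show "C \<in> {C \<in> components W. \<forall>\<zeta>\<in>C. - \<sigma> * circle_deriv \<omega> \<zeta> > 0}"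
        using component_sign[of C \<zeta> "- \<sigma>"] mem[OF \<zeta>(1)] \<zeta>(2) by blast
    next
      fix C assume C: "C \<in> {C \<in> components W. \<forall>\<zeta>\<in>C. - \<sigma> * circle_deriv \<omega> \<zeta> > 0}"
      then obtain \<zeta> where \<zeta>: "\<zeta> \<in> C" "\<omega> \<zeta> = l"
        using component_level_unique[OF _ assms] by blast
      have "C \<subseteq> W" using C in_components_subset by blast
      then have "\<zeta> \<in> level \<sigma> l" using C \<zeta> by (auto simp: level_def W_def)
      moreover have "C = connected_component_set W \<zeta>"
        using C \<zeta> by (metis (mono_tags, lifting) components_iff connected_component_eq mem_Collect_eq)
      ultimately show "C \<in> connected_component_set W ` level \<sigma> l" by blast
    qed
  qed
  then show ?thesis
    unfolding n_count_def arcs by (simp add: bij_betw_same_card)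
qed

text \<open>Every component contains a point of one of the two level sets. As \<open>card\<close> is
  0 on infinite sets, this is what makes \<open>n_count\<close> a genuine count.\<close>

lemma finite_components_W:
  assumes "l \<in> {l1<..<l2}" "finite (level 1 l)" "finite (level (-1) l)"
  shows "finite (components W)"
proof (rule finite_subset)
  show "components W \<subseteq> connected_component_set W ` (level 1 l \<union> level (-1) l)"
  proof
    fix C assume C: "C \<in> components W"
    then obtain \<zeta> where \<zeta>: "\<zeta> \<in> C" "\<omega> \<zeta> = l"
      using component_level_unique[OF _ assms(1)] by blast
    then have "\<zeta> \<in> W" using C in_components_subset by blast
    then have "\<zeta> \<in> level 1 l \<union> level (-1) l"
      using \<zeta> deriv_nonzero[of \<zeta>] by (auto simp: level_def W_def)
    moreover have "C = connected_component_set W \<zeta>"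
      using C \<zeta> by (metis components_iff connected_component_eq mem_Collect_eq)
    ultimately show "C \<in> connected_component_set W ` (level 1 l \<union> level (-1) l)" by blast
  qed
qed (use assms in auto)

section \<open>One-sided behaviour at a level\<close>

lemma germ_at_S:
  assumes "l \<in> {l1<..<l2}" "cis t \<in> S"
  shows "lim_plus \<omega> (cis t) < l \<and> (\<forall>\<^sub>F s in at_right t. f s < l) \<or>
      l < lim_plus \<omega> (cis t) \<and> (\<forall>\<^sub>F s in at_right t. \<not> f s < l)"
    "lim_minus \<omega> (cis t) < l \<and> (\<forall>\<^sub>F s in at_left t. f s < l) \<or>
      l < lim_minus \<omega> (cis t) \<and> (\<forall>\<^sub>F s in at_left t. \<not> f s < l)"
proof -
  \<comment> \<open>Threshold values avoid the interval, so the comparison of either limit with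
    \<open>l\<close> is strict and persists nearby.\<close>
  have "lim_plus \<omega> (cis t) \<noteq> l" "lim_minus \<omega> (cis t) \<noteq> l"
    using lim_not_in[OF assms(2)] assms(1) by auto
  then consider "lim_plus \<omega> (cis t) < l" | "l < lim_plus \<omega> (cis t)"
    by linarith
  then show "lim_plus \<omega> (cis t) < l \<and> (\<forall>\<^sub>F s in at_right t. f s < l) \<or>
      l < lim_plus \<omega> (cis t) \<and> (\<forall>\<^sub>F s in at_right t. \<not> f s < l)"
  proof cases
    case 1
    then show ?thesis using order_tendstoD(2)[OF tendsto_lim_plus[OF assms(2)]] by blast
  next
    case 2
    then have "\<forall>\<^sub>F s in at_right t. l < f s"
      using order_tendstoD(1)[OF tendsto_lim_plus[OF assms(2)]] by blast
    then have "\<forall>\<^sub>F s in at_right t. \<not> f s < l" by eventually_elim simp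
    with 2 show ?thesis by blast
  qed
  consider "lim_minus \<omega> (cis t) < l" | "l < lim_minus \<omega> (cis t)"
    using \<open>lim_minus \<omega> (cis t) \<noteq> l\<close> by linarith
  then show "lim_minus \<omega> (cis t) < l \<and> (\<forall>\<^sub>F s in at_left t. f s < l) \<or>
      l < lim_minus \<omega> (cis t) \<and> (\<forall>\<^sub>F s in at_left t. \<not> f s < l)"
  proof cases
    case 1
    then show ?thesis using order_tendstoD(2)[OF tendsto_lim_minus[OF assms(2)]] by blast
  next
    case 2
    then have "\<forall>\<^sub>F s in at_left t. l < f s"
      using order_tendstoD(1)[OF tendsto_lim_minus[OF assms(2)]] by blast
    then have "\<forall>\<^sub>F s in at_left t. \<not> f s < l" by eventually_elim simp
    with 2 show ?thesis by blast
  qed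
qed

lemma germ_off_level:
  assumes "cis t \<notin> S" "f t \<noteq> l"
  shows "f t < l \<and> (\<forall>\<^sub>F s in at t. f s < l) \<or> l < f t \<and> (\<forall>\<^sub>F s in at t. \<not> f s < l)"
proof (cases "f t < l")
  case True
  then show ?thesis
    using f_isCont[OF assms(1)] order_tendstoD(2) by (auto simp: isCont_def)
next
  case False
  then have "\<forall>\<^sub>F s in at t. l < f s"
    using f_isCont[OF assms(1)] order_tendstoD(1)[of f "f t" "at t" l] assms by (auto simp: isCont_def)
  then have "\<forall>\<^sub>F s in at t. \<not> f s < l" by eventually_elim simp
  with False assms show ?thesis by simp
qed

text \<open>Regularity gives a nonzero derivative at \<open>t\<close>, and its sign decides on which
  side of \<open>t\<close> the values lie below \<open>l\<close>.\<close>

lemma germ_on_level: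
  assumes "l \<in> {l1<..<l2}" "cis t \<notin> S" "f t = l"
  shows "circle_deriv \<omega> (cis t) < 0 \<and>
      (\<forall>\<^sub>F s in at_left t. \<not> f s < l) \<and> (\<forall>\<^sub>F s in at_right t. f s < l) \<or>
    0 < circle_deriv \<omega> (cis t) \<and>
      (\<forall>\<^sub>F s in at_left t. f s < l) \<and> (\<forall>\<^sub>F s in at_right t. \<not> f s < l)"
proof -
  have W: "cis t \<in> W" using assms by (simp add: cis_in_W)
  note D = f_DERIV[OF assms(2)]
  consider "circle_deriv \<omega> (cis t) < 0" | "0 < circle_deriv \<omega> (cis t)"
    using deriv_nonzero[OF W] by linarith
  then show ?thesis
  proof cases
    case 1
    obtain d where d: "d > 0" "\<And>h. 0 < h \<Longrightarrow> h < d \<Longrightarrow> f (t + h) < f t"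
      using DERIV_neg_dec_right[OF D 1] by blast
    obtain e where e: "e > 0" "\<And>h. 0 < h \<Longrightarrow> h < e \<Longrightarrow> f t < f (t - h)"
      using DERIV_neg_dec_left[OF D 1] by blast
    have "f s < l" if "t < s" "s < t + d" for s using d(2)[of "s - t"] that assms by simp
    then have "\<forall>\<^sub>F s in at_right t. f s < l"
      unfolding eventually_at_right_field using d by (intro exI[of _ "t + d"]) auto
    moreover have "\<not> f s < l" if "t - e < s" "s < t" for s using e(2)[of "t - s"] that assms by simp
    then have "\<forall>\<^sub>F s in at_left t. \<not> f s < l"
      unfolding eventually_at_left_field using e by (intro exI[of _ "t - e"]) auto
    ultimately show ?thesis using 1 by blast
  next
    case 2
    obtain d where d: "d > 0" "\<And>h. 0 < h \<Longrightarrow> h < d \<Longrightarrow> f t < f (t + h)"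
      using DERIV_pos_inc_right[OF D 2] by blast
    obtain e where e: "e > 0" "\<And>h. 0 < h \<Longrightarrow> h < e \<Longrightarrow> f (t - h) < f t"
      using DERIV_pos_inc_left[OF D 2] by blast
    have "\<not> f s < l" if "t < s" "s < t + d" for s using d(2)[of "s - t"] that assms by simp
    then have "\<forall>\<^sub>F s in at_right t. \<not> f s < l"
      unfolding eventually_at_right_field using d by (intro exI[of _ "t + d"]) auto
    moreover have "f s < l" if "t - e < s" "s < t" for s using e(2)[of "t - s"] that assms by simp
    then have "\<forall>\<^sub>F s in at_left t. f s < l"
      unfolding eventually_at_left_field using e by (intro exI[of _ "t - e"]) auto
    ultimately show ?thesis using 2 by blast
  qed
qed

section \<open>Transitions of the sublevel condition and the resulting arcs\<close>

lemma periodic_germs: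
  assumes "l \<in> {l1<..<l2}"
  shows "periodic_germs (\<lambda>s. f s < l)"
proof
  fix t :: real
  have "((\<forall>\<^sub>F s in at_right t. f s < l) \<or> (\<forall>\<^sub>F s in at_right t. \<not> f s < l)) \<and>
    ((\<forall>\<^sub>F s in at_left t. f s < l) \<or> (\<forall>\<^sub>F s in at_left t. \<not> f s < l))"
  proof (cases "cis t \<in> S")
    case True
    then show ?thesis using germ_at_S[OF assms True] by blast
  next
    case False
    then show ?thesis
      using germ_on_level[OF assms False] germ_off_level[OF False, of l]
      unfolding eventually_at_split by blast
  qed
  then show "(\<forall>\<^sub>F s in at_right t. f s < l) \<or> (\<forall>\<^sub>F s in at_right t. \<not> f s < l)"
    "(\<forall>\<^sub>F s in at_left t. f s < l) \<or> (\<forall>\<^sub>F s in at_left t. \<not> f s < l)"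
    by blast+
qed simp

text \<open>Neither limit lies in the open interval, so a jump interval that contains the single
  level \<open>l\<close> contains all of it. Hence the jumps across \<open>l\<close> are the same
  for every \<open>l\<close> in the interval.\<close>

lemma crossing_jump_iff:
  assumes "l \<in> {l1<..<l2}" "\<eta> \<in> S"
  shows "\<eta> \<in> S_of \<omega> S {l1<..<l2} \<inter> jump_points 1 \<omega> S \<longleftrightarrow> lim_plus \<omega> \<eta> < l \<and> l < lim_minus \<omega> \<eta>"
    "\<eta> \<in> S_of \<omega> S {l1<..<l2} \<inter> jump_points (-1) \<omega> S \<longleftrightarrow> lim_minus \<omega> \<eta> < l \<and> l < lim_plus \<omega> \<eta>"
proof -
  have sub: "{l1<..<l2} \<subseteq> {a..b} \<longleftrightarrow> a < l \<and> l < b" if "a \<notin> {l1<..<l2}" "b \<notin> {l1<..<l2}" for a b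
  proof
    assume "{l1<..<l2} \<subseteq> {a..b}"
    then have "l \<in> {a..b}" using assms by blast
    then show "a < l \<and> l < b" using that assms by (auto simp: order_less_le)
  qed (use that assms in auto)
  show "\<eta> \<in> S_of \<omega> S {l1<..<l2} \<inter> jump_points 1 \<omega> S \<longleftrightarrow> lim_plus \<omega> \<eta> < l \<and> l < lim_minus \<omega> \<eta>"
    "\<eta> \<in> S_of \<omega> S {l1<..<l2} \<inter> jump_points (-1) \<omega> S \<longleftrightarrow> lim_minus \<omega> \<eta> < l \<and> l < lim_plus \<omega> \<eta>"
    using sub[OF lim_not_in[OF assms(2)]] sub[OF lim_not_in(2)[OF assms(2)] lim_not_in(1)[OF assms(2)]] assms(2)
    by (auto simp: S_of_def jump_points_def jump_interval_def)
qed

text \<open>Off \<open>S\<close>, a point with \<open>f t \<noteq> l\<close> has equal germs on both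
  sides and is no transition, so transitions are level points or jumps, sorted by direction. The
  last claim lets germs replace pointwise values away from the exceptional points.\<close>

lemma sublevel_structure:
  assumes l: "l \<in> {l1<..<l2}"
  defines "germ_inside \<equiv> periodic_germs.germ_inside (\<lambda>s. f s < l)"
    and "enters \<equiv> periodic_germs.enters (\<lambda>s. f s < l)"
    and "leaves \<equiv> periodic_germs.leaves (\<lambda>s. f s < l)"
  shows "cis ` enters = level 1 l \<union> (S_of \<omega> S {l1<..<l2} \<inter> jump_points 1 \<omega> S)"
    "cis ` leaves = level (-1) l \<union> (S_of \<omega> S {l1<..<l2} \<inter> jump_points (-1) \<omega> S)"
    "\<And>t. cis t \<notin> S \<union> level 1 l \<union> level (-1) l \<Longrightarrow> t \<in> germ_inside \<longleftrightarrow> f t < l"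
proof -
  interpret G: periodic_germs "\<lambda>s. f s < l" using periodic_germs[OF l] .
  have enters: "t \<in> enters \<longleftrightarrow> cis t \<in> level 1 l \<union> (S_of \<omega> S {l1<..<l2} \<inter> jump_points 1 \<omega> S)"
    and leaves: "t \<in> leaves \<longleftrightarrow> cis t \<in> level (-1) l \<union> (S_of \<omega> S {l1<..<l2} \<inter> jump_points (-1) \<omega> S)"
    for t
  proof -
    have nS: "\<eta> \<notin> S \<Longrightarrow> \<eta> \<notin> jump_points \<sigma> \<omega> S" for \<sigma> \<eta> by (simp add: jump_points_def)
    have "(t \<in> enters \<longleftrightarrow> cis t \<in> level 1 l \<union> (S_of \<omega> S {l1<..<l2} \<inter> jump_points 1 \<omega> S)) \<and>
      (t \<in> leaves \<longleftrightarrow> cis t \<in> level (-1) l \<union> (S_of \<omega> S {l1<..<l2} \<inter> jump_points (-1) \<omega> S))"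
    proof (cases "cis t \<in> S")
      case True
      then have "cis t \<notin> level \<sigma> l" for \<sigma> by (simp add: level_def)
      then show ?thesis
        using germ_at_S[OF l True] crossing_jump_iff[OF l True] G.not_both[of t]
        unfolding enters_def leaves_def G.enters_def G.leaves_def by auto
    next
      case False
      show ?thesis
      proof (cases "f t = l")
        case True
        then show ?thesis
          using germ_on_level[OF l False True] nS[OF False] False G.not_both[of t]
          unfolding enters_def leaves_def G.enters_def G.leaves_def level_def by auto
      next
        case ne: False
        then show ?thesis
          using germ_off_level[OF False ne] nS[OF False] G.not_both[of t]
          unfolding enters_def leaves_def G.enters_def G.leaves_def level_def eventually_at_split by auto
      qed
    qed
    then show "t \<in> enters \<longleftrightarrow> cis t \<in> level 1 l \<union> (S_of \<omega> S {l1<..<l2} \<inter> jump_points 1 \<omega> S)"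
      "t \<in> leaves \<longleftrightarrow> cis t \<in> level (-1) l \<union> (S_of \<omega> S {l1<..<l2} \<inter> jump_points (-1) \<omega> S)"
      by blast+
  qed
  have circ: "level \<sigma> l \<union> (S_of \<omega> S {l1<..<l2} \<inter> jump_points \<sigma> \<omega> S) \<subseteq> range cis" for \<sigma>
    using S_circle by (auto simp: level_def jump_points_def unit_circle_eq_cis_image[symmetric])
  show "cis ` enters = level 1 l \<union> (S_of \<omega> S {l1<..<l2} \<inter> jump_points 1 \<omega> S)"
    using enters circ[of 1] by blast
  show "cis ` leaves = level (-1) l \<union> (S_of \<omega> S {l1<..<l2} \<inter> jump_points (-1) \<omega> S)"
    using leaves circ[of "-1"] by blast
  fix t assume t: "cis t \<notin> S \<union> level 1 l \<union> level (-1) l"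
  have "f t \<noteq> l"
  proof
    assume "f t = l"
    then have "circle_deriv \<omega> (cis t) \<noteq> 0" using t l by (intro deriv_nonzero) (simp add: cis_in_W)
    then show False using t \<open>f t = l\<close> by (auto simp: level_def)
  qed
  then show "t \<in> germ_inside \<longleftrightarrow> f t < l"
    using germ_off_level[of t l] t G.not_both[of t]
    unfolding germ_inside_def G.germ_inside_def eventually_at_split by auto
qed

text \<open>Here \<open>m\<close> counts the entering transitions; counting the leaving ones gives
  the second expression, because each arc has one end of either kind.\<close>

lemma sublevel_arcs:
  assumes l: "l \<in> {l1<..<l2}" and Linf: "circle_Linf \<omega>" and l_less: "ereal l < circle_esssup \<omega>"
  defines "m \<equiv> card (level 1 l) + s_count 1 \<omega> S {l1<..<l2}"
  shows "\<exists>\<alpha> \<beta> :: nat \<Rightarrow> complex.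
      (\<forall>j\<in>{1..m}. \<alpha> j \<in> unit_circle \<and> \<beta> j \<in> unit_circle \<and> \<alpha> j \<noteq> \<beta> j \<and>
         circle_arc (\<alpha> j) (\<beta> j) \<subseteq> unit_circle - S_of \<omega> S {l1<..<l2}) \<and>
      disjoint_family_on (\<lambda>j. closure (circle_arc (\<alpha> j) (\<beta> j))) {1..m} \<and>
      (AE \<zeta> in circle_measure.
         \<zeta> \<in> sublevel \<omega> l \<longleftrightarrow> \<zeta> \<in> (\<Union>j\<in>{1..m}. circle_arc (\<alpha> j) (\<beta> j)))"
    and "m = card (level (-1) l) + s_count (-1) \<omega> S {l1<..<l2}"
    and "finite (level 1 l)" and "finite (level (-1) l)"
proof -
  interpret G: periodic_germs "\<lambda>s. f s < l" using periodic_germs[OF l] .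
  note enters = sublevel_structure(1)[OF l] and leaves = sublevel_structure(2)[OF l]
    and germ_inside = sublevel_structure(3)[OF l]
  show fin: "finite (level 1 l)" "finite (level (-1) l)"
    using G.finite_transitions unfolding enters leaves by simp_all
  have disj: "level \<sigma> l \<inter> (S_of \<omega> S {l1<..<l2} \<inter> jump_points \<sigma> \<omega> S) = {}" for \<sigma>
    by (auto simp: level_def jump_points_def)
  have finS: "finite (S_of \<omega> S {l1<..<l2} \<inter> jump_points \<sigma> \<omega> S)" for \<sigma>
    using finite_S by (rule rev_finite_subset) (auto simp: jump_points_def)
  have card_enters: "card (cis ` G.enters) = m"
    unfolding enters m_def s_count_def using fin finS disj by (simp add: card_Un_disjoint)
  have card_leaves: "card (cis ` G.leaves) = card (level (-1) l) + s_count (-1) \<omega> S {l1<..<l2}"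
    unfolding leaves s_count_def using fin finS disj by (simp add: card_Un_disjoint)
  \<comment> \<open>Outside this finite, hence null, set the germs agree with the pointwise
    values.\<close>
  define F where "F = S \<union> level 1 l \<union> level (-1) l"
  have "finite F" using fin finite_S by (simp add: F_def)
  then have AE_F: "AE \<zeta> in circle_measure. \<zeta> \<notin> F" by (rule finite_null_circle_measure)
  have space: "\<zeta> \<in> space circle_measure \<Longrightarrow> \<exists>t. \<zeta> = cis t" for \<zeta>
    using unit_circle_eq_cis_image by (auto simp: circle_measure_def space_restrict_space)
  have iff: "t \<in> G.germ_inside \<longleftrightarrow> f t < l" if "cis t \<notin> F" for t
    using germ_inside that by (simp add: F_def)
  \<comment> \<open>Otherwise \<open>\<omega> < l\<close> would hold off the null set
    \<open>F\<close>, although \<open>l\<close> lies below the essential supremum.\<close>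
  have "G.germ_inside \<noteq> UNIV"
  proof
    assume all: "G.germ_inside = UNIV"
    have "AE \<zeta> in circle_measure. ereal (\<omega> \<zeta>) \<le> ereal l"
      using AE_F
    proof (rule AE_mp, intro AE_I2 impI)
      fix \<zeta> assume "\<zeta> \<in> space circle_measure" "\<zeta> \<notin> F"
      then show "ereal (\<omega> \<zeta>) \<le> ereal l" using space iff all by fastforce
    qed
    moreover have "(\<lambda>\<zeta>. ereal (\<omega> \<zeta>)) \<in> borel_measurable circle_measure"
      using Linf by (intro borel_measurable_ereal) (simp add: circle_Linf_def)
    ultimately have "circle_esssup \<omega> \<le> ereal l"
      unfolding circle_esssup_def by (intro esssup_I)
    with l_less show False by simp
  qed
  from G.germ_inside_arcs[OF this card_enters] obtain \<alpha> \<beta> :: "nat \<Rightarrow> complex" where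
    ends: "\<And>j. j \<in> {1..m} \<Longrightarrow> \<alpha> j \<in> unit_circle \<and> \<beta> j \<in> unit_circle \<and> \<alpha> j \<noteq> \<beta> j"
    and disj: "disjoint_family_on (\<lambda>j. closure (circle_arc (\<alpha> j) (\<beta> j))) {1..m}"
    and un: "(\<Union>j\<in>{1..m}. circle_arc (\<alpha> j) (\<beta> j)) = cis ` G.germ_inside"
    and leaves_m: "card (cis ` G.leaves) = m"
    by blast
  show "m = card (level (-1) l) + s_count (-1) \<omega> S {l1<..<l2}"
    using leaves_m card_leaves by simp
  have cis_inside: "cis t \<in> cis ` G.germ_inside \<longleftrightarrow> t \<in> G.germ_inside" for t
    by (rule cis_mem_image_periodic) simp
  \<comment> \<open>Jumps across the interval are transitions, and these never lie in
    \<open>germ_inside\<close>, so the arcs avoid them.\<close>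
  have "cis t \<notin> S_of \<omega> S {l1<..<l2}" if "t \<in> G.germ_inside" for t
  proof
    assume "cis t \<in> S_of \<omega> S {l1<..<l2}"
    moreover from this have "cis t \<in> jump_points 1 \<omega> S \<union> jump_points (-1) \<omega> S"
      by (simp add: S_of_def)
    ultimately have "cis t \<in> cis ` G.enters \<or> cis t \<in> cis ` G.leaves"
      unfolding enters leaves by blast
    then have "t \<in> G.enters \<or> t \<in> G.leaves"
      using cis_mem_image_periodic[of G.enters t] cis_mem_image_periodic[of G.leaves t] by simp
    then show False using that G.disjoint_classes by blast
  qed
  then have "cis ` G.germ_inside \<subseteq> unit_circle - S_of \<omega> S {l1<..<l2}"
    by auto
  then have "circle_arc (\<alpha> j) (\<beta> j) \<subseteq> unit_circle - S_of \<omega> S {l1<..<l2}" if "j \<in> {1..m}" for j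
    using UN_upper[OF that, of "\<lambda>j. circle_arc (\<alpha> j) (\<beta> j)"] unfolding un by blast
  moreover have "AE \<zeta> in circle_measure. \<zeta> \<in> sublevel \<omega> l \<longleftrightarrow> \<zeta> \<in> cis ` G.germ_inside"
    using AE_F
  proof (rule AE_mp, intro AE_I2 impI)
    fix \<zeta> assume "\<zeta> \<in> space circle_measure" "\<zeta> \<notin> F"
    then obtain t where "\<zeta> = cis t" using space by blast
    then show "\<zeta> \<in> sublevel \<omega> l \<longleftrightarrow> \<zeta> \<in> cis ` G.germ_inside"
      using iff[of t] cis_inside \<open>\<zeta> \<notin> F\<close> by (simp add: sublevel_def)
  qed
  ultimately show "\<exists>\<alpha> \<beta> :: nat \<Rightarrow> complex.
      (\<forall>j\<in>{1..m}. \<alpha> j \<in> unit_circle \<and> \<beta> j \<in> unit_circle \<and> \<alpha> j \<noteq> \<beta> j \<and>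
         circle_arc (\<alpha> j) (\<beta> j) \<subseteq> unit_circle - S_of \<omega> S {l1<..<l2}) \<and>
      disjoint_family_on (\<lambda>j. closure (circle_arc (\<alpha> j) (\<beta> j))) {1..m} \<and>
      (AE \<zeta> in circle_measure.
         \<zeta> \<in> sublevel \<omega> l \<longleftrightarrow> \<zeta> \<in> (\<Union>j\<in>{1..m}. circle_arc (\<alpha> j) (\<beta> j)))"
    using ends disj unfolding un[symmetric]
    by (intro exI[of _ \<alpha>] exI[of _ \<beta>] conjI ballI) (assumption | blast)+
qed

end

theorem theorem6p5:
  fixes \<omega> :: "complex \<Rightarrow> real" and S :: "complex set" and l1 l2 :: real
  assumes "circle_Linf \<omega>"
    and "\<not> (\<exists>c. AE \<zeta> in circle_measure. \<omega> \<zeta> = c)"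
    and "finite S" and "S \<subseteq> unit_circle"
    and "circle_C1_on (unit_circle - S) \<omega>"
    and "\<forall>\<eta>\<in>S. has_one_sided_limits \<omega> \<eta>"
    and "\<forall>\<eta>\<in>S. genuine_singularity \<omega> \<eta>"
    and "l1 < l2"
    and "{l1<..<l2} \<subseteq> {x. circle_essinf \<omega> < ereal x \<and> ereal x < circle_esssup \<omega>} - Lambda_exc \<omega> S"
  shows "finite (preimage_arcs \<omega> S {l1<..<l2}) \<and>
    (\<exists>m::nat.
      (\<forall>l\<in>{l1<..<l2}. \<exists>\<alpha> \<beta> :: nat \<Rightarrow> complex.
        (\<forall>j\<in>{1..m}. \<alpha> j \<in> unit_circle \<and> \<beta> j \<in> unit_circle \<and> \<alpha> j \<noteq> \<beta> j \<and>
           circle_arc (\<alpha> j) (\<beta> j) \<subseteq> unit_circle - S_of \<omega> S {l1<..<l2}) \<and>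
        disjoint_family_on (\<lambda>j. closure (circle_arc (\<alpha> j) (\<beta> j))) {1..m} \<and>
        (AE \<zeta> in circle_measure.
           \<zeta> \<in> sublevel \<omega> l \<longleftrightarrow> \<zeta> \<in> (\<Union>j\<in>{1..m}. circle_arc (\<alpha> j) (\<beta> j)))) \<and>
      (\<forall>\<sigma>\<in>{1, -1}. m = n_count \<sigma> \<omega> S {l1<..<l2} + s_count \<sigma> \<omega> S {l1<..<l2}))"
proof -
  interpret regular_interval \<omega> S l1 l2
    using assms by unfold_locales auto
  \<comment> \<open>No level occurs in this expression, so \<open>m\<close> is independent of
    \<open>l\<close>; \<open>card_level\<close> translates it to each particular level.\<close>
  define m where "m = n_count 1 \<omega> S {l1<..<l2} + s_count 1 \<omega> S {l1<..<l2}"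
  have m: "m = card (level 1 l) + s_count 1 \<omega> S {l1<..<l2}" if "l \<in> {l1<..<l2}" for l
    using card_level[OF that] by (simp add: m_def)
  have less: "ereal l < circle_esssup \<omega>" if "l \<in> {l1<..<l2}" for l
    using assms(9) that by blast
  \<comment> \<open>A fixed level serves the claims that do not mention one: finiteness of the
    preimage arcs and the count for both signs.\<close>
  obtain l where l: "l \<in> {l1<..<l2}" using dense[OF assms(8)] by auto
  note arcs = sublevel_arcs[OF _ assms(1) less]
  show ?thesis
  proof (intro conjI exI[of _ m] ballI)
    show "finite (preimage_arcs \<omega> S {l1<..<l2})"
      using finite_components_W[OF l] arcs(3,4)[OF l l] by (simp add: preimage_arcs_def W_def)
  next
    fix l assume l: "l \<in> {l1<..<l2}"
    show "\<exists>\<alpha> \<beta> :: nat \<Rightarrow> complex.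
        (\<forall>j\<in>{1..m}. \<alpha> j \<in> unit_circle \<and> \<beta> j \<in> unit_circle \<and> \<alpha> j \<noteq> \<beta> j \<and>
           circle_arc (\<alpha> j) (\<beta> j) \<subseteq> unit_circle - S_of \<omega> S {l1<..<l2}) \<and>
        disjoint_family_on (\<lambda>j. closure (circle_arc (\<alpha> j) (\<beta> j))) {1..m} \<and>
        (AE \<zeta> in circle_measure.
           \<zeta> \<in> sublevel \<omega> l \<longleftrightarrow> \<zeta> \<in> (\<Union>j\<in>{1..m}. circle_arc (\<alpha> j) (\<beta> j)))"
      unfolding m[OF l] by (rule arcs(1)[OF l l])
  next
    fix \<sigma> :: real assume "\<sigma> \<in> {1, -1}"
    then show "m = n_count \<sigma> \<omega> S {l1<..<l2} + s_count \<sigma> \<omega> S {l1<..<l2}"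
      using arcs(2)[OF l l] m[OF l] card_level[OF l] by auto
  qed
qed

end
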